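(* Let $X_1$ and $X_2$ be arbitrary compact metric spaces. Suppose that a map $T:\operatorname{Lip}(X_1)\to\operatorname{Lip}(X_2)$ is 2-local in $\operatorname{Iso}((\operatorname{Lip}(X_1),\|\cdot\|_{\Sigma}), (\operatorname{Lip}(X_2),\|\cdot\|_{\Sigma}))$. Then $T \in \operatorname{Iso}((\operatorname{Lip}(X_1),\|\cdot\|_{\Sigma}), (\operatorname{Lip}(X_2),\|\cdot\|_{\Sigma}))$.
   Context: For a compact metric space $(X,d)$, $\operatorname{Lip}(X)$ is the algebra of all complex-valued continuous functions $f$ on $X$ with $L(f)=\sup_{x\neq y}\frac{|f(x)-f(y)|}{d(x,y)}<\infty$, and $\|f\|_{\Sigma}=\|f\|_{\infty}+L(f)$, where $\|\cdot\|_\infty$ is the supremum norm. For normed spaces $\mathfrak{M}_1,\mathfrak{M}_2$, $\operatorname{Iso}(\mathfrak{M}_1,\mathfrak{M}_2)$ is the set of all surjective isometries (distance preserving maps, not necessarily linear) from $\mathfrak{M}_1$ onto $\mathfrak{M}_2$. A map $T:\mathfrak{M}_1\to\mathfrak{M}_2$ (no linearity, continuity or surjectivity assumed) is 2-local in $\operatorname{Iso}(\mathfrak{M}_1,\mathfrak{M}_2)$ if for every $x,y\in\mathfrak{M}_1$ there is $T_{x,y}\in\operatorname{Iso}(\mathfrak{M}_1,\mathfrak{M}_2)$ such that $T(x)=T_{x,y}(x)$ and $T(y)=T_{x,y}(y)$. *)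

theory Defs
  imports "HOL-Analysis.Analysis"
begin

text \<open>
  The suprema are taken in \<^typ>\<open>ennreal\<close>, so that they always exist, are allowed to be
  infinite, and a supremum over the empty set (e.g. over the pairs of distinct points of a
  one-point space) is \<open>0\<close>.
\<close>

definition unorm :: "'a set \<Rightarrow> ('a \<Rightarrow> complex) \<Rightarrow> ennreal" where
  "unorm X f = (SUP x\<in>X. ennreal (cmod (f x)))"

definition lip_const :: "'a::metric_space set \<Rightarrow> ('a \<Rightarrow> complex) \<Rightarrow> ennreal" where
  "lip_const X f =
     (SUP (x, y)\<in>{(x, y). x \<in> X \<and> y \<in> X \<and> x \<noteq> y}. ennreal (cmod (f x - f y) / dist x y))"

text \<open>
  A function on \<open>X\<close> is represented by its extension by \<open>0\<close> to the whole type. This makes the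
  representation unique, and the pointwise operations on functions restrict to those of \<open>Lip X\<close>.
\<close>

definition Lip :: "'a::metric_space set \<Rightarrow> ('a \<Rightarrow> complex) set" where
  "Lip X = {f. continuous_on X f \<and> lip_const X f < \<infinity> \<and> (\<forall>x. x \<notin> X \<longrightarrow> f x = 0)}"

text \<open>
  For compact \<open>X\<close> and \<open>f \<in> Lip X\<close> both summands are finite, so \<^const>\<open>enn2real\<close> is a faithful
  conversion there.
\<close>

definition sigma_norm :: "'a::metric_space set \<Rightarrow> ('a \<Rightarrow> complex) \<Rightarrow> real" where
  "sigma_norm X f = enn2real (unorm X f) + enn2real (lip_const X f)"

text \<open>
  A normed space is given by its carrier and its norm. Only the values of a map on the carrier
  of its domain matter.
\<close>

definition Iso ::
  "'v::minus set \<Rightarrow> ('v \<Rightarrow> real) \<Rightarrow> 'w::minus set \<Rightarrow> ('w \<Rightarrow> real) \<Rightarrow> ('v \<Rightarrow> 'w) set" where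
  "Iso M\<^sub>1 N\<^sub>1 M\<^sub>2 N\<^sub>2 =
     {U. U ` M\<^sub>1 = M\<^sub>2 \<and> (\<forall>f\<in>M\<^sub>1. \<forall>g\<in>M\<^sub>1. N\<^sub>2 (U f - U g) = N\<^sub>1 (f - g))}"

definition two_local_in_Iso ::
  "'v::minus set \<Rightarrow> ('v \<Rightarrow> real) \<Rightarrow> 'w::minus set \<Rightarrow> ('w \<Rightarrow> real) \<Rightarrow> ('v \<Rightarrow> 'w) \<Rightarrow> bool" where
  "two_local_in_Iso M\<^sub>1 N\<^sub>1 M\<^sub>2 N\<^sub>2 T \<longleftrightarrow>
     (\<forall>f\<in>M\<^sub>1. \<forall>g\<in>M\<^sub>1. \<exists>U\<in>Iso M\<^sub>1 N\<^sub>1 M\<^sub>2 N\<^sub>2. T f = U f \<and> T g = U g)"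

end

theory Submission
  imports Defs
begin

text \<open>
  A 2-local map preserves distances, so only surjectivity is at stake. A surjective isometry \<open>U\<close>
  satisfies \<open>\<bar>U f - U g\<bar> = \<bar>f - g\<bar> \<circ> p\<close> for some isometry \<open>p\<close> of \<open>X\<^sub>2\<close> onto \<open>X\<^sub>1\<close>; hence so does a
  2-local map \<open>T\<close>, with \<open>p\<close> depending on \<open>f\<close> and \<open>g\<close>. The functionals
  \<open>f \<mapsto> sup \<Sum>\<^sub>i \<bar>f (s\<^sub>i)\<bar>\<^sup>2\<close>, where \<open>s\<close> runs over the \<open>n\<close>-point \<open>\<epsilon>\<close>-nets, do not see \<open>p\<close> and are
  convex enough for \<open>T - T 0\<close> to be additive. Up to a linear isometry of the scalars
  it then maps every \<open>f\<close> into the range of \<open>f\<close>, and so is composition with an isometry.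

  The form of a surjective isometry \<open>U\<close> is found as follows. By the Mazur-Ulam theorem
  \<open>V = U - U 0\<close> is additive. For each \<open>f\<close> there is a unimodular constant \<open>c\<close> with
  \<open>\<parallel>f + c\<parallel> = \<parallel>f\<parallel> + 1\<close>; transported by \<open>V\<close> and tested at peak functions on \<open>X\<^sub>2\<close>, this forces
  all \<open>V c\<close> to be constant. If \<open>V\<close> fixes the constants, the support functions of the ranges of \<open>f\<close> and \<open>V f\<close> differ by the
  constant \<open>lip f - lip (V f)\<close>. It vanishes since functions whose range has a corner are dense.
  Therefore \<open>V\<close> preserves the order and the modulus of real functions and is a composition operator.
\<close>

section \<open>Lipschitz functions\<close>

definition cst :: "'a set \<Rightarrow> complex \<Rightarrow> 'a \<Rightarrow> complex" where
  "cst X c = (\<lambda>x. if x \<in> X then c else 0)"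

definition sup_norm :: "'a set \<Rightarrow> ('a \<Rightarrow> complex) \<Rightarrow> real" where
  "sup_norm X f = enn2real (unorm X f)"

definition lip :: "'a::metric_space set \<Rightarrow> ('a \<Rightarrow> complex) \<Rightarrow> real" where
  "lip X f = enn2real (lip_const X f)"

text \<open>The direction is that of a substitution: \<open>f \<mapsto> f \<circ> p\<close> turns
  functions on \<open>X\<close> into functions on \<open>Y\<close>.\<close>

definition isometry_onto :: "('b::metric_space \<Rightarrow> 'a::metric_space) \<Rightarrow> 'b set \<Rightarrow> 'a set \<Rightarrow> bool" where
  "isometry_onto p Y X \<longleftrightarrow> p ` Y = X \<and> (\<forall>a\<in>Y. \<forall>b\<in>Y. dist (p a) (p b) = dist a b)"

lemma sigma_norm_eq: "sigma_norm X f = sup_norm X f + lip X f"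
  by (simp add: sigma_norm_def sup_norm_def lip_def)

lemma sup_norm_nonneg: "sup_norm X f \<ge> 0" and lip_nonneg: "lip X f \<ge> 0"
  by (simp_all add: sup_norm_def lip_def)

lemma lip_const_le:
  assumes "\<And>x y. x \<in> X \<Longrightarrow> y \<in> X \<Longrightarrow> cmod (f x - f y) \<le> B * dist x y"
  shows "lip_const X f \<le> ennreal B"
  unfolding lip_const_def
proof (rule SUP_least, clarify)
  fix x y assume xy: "x \<in> X" "y \<in> X" "x \<noteq> y"
  then show "ennreal (cmod (f x - f y) / dist x y) \<le> ennreal B"
    using assms[OF xy(1,2)] by (intro ennreal_leI) (simp add: divide_le_eq)
qed

lemma lip_le:
  assumes "\<And>x y. x \<in> X \<Longrightarrow> y \<in> X \<Longrightarrow> cmod (f x - f y) \<le> B * dist x y" and "B \<ge> 0"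
  shows "lip X f \<le> B"
  unfolding lip_def using enn2real_mono[OF lip_const_le[OF assms(1)]] assms(2) by simp

lemma LipI:
  assumes B: "\<And>x y. x \<in> X \<Longrightarrow> y \<in> X \<Longrightarrow> cmod (f x - f y) \<le> B * dist x y"
    and 0: "\<And>x. x \<notin> X \<Longrightarrow> f x = 0"
  shows "f \<in> Lip X"
proof -
  have "cmod (f x - f y) \<le> \<bar>B\<bar> * dist x y" if "x \<in> X" "y \<in> X" for x y
    using B[OF that] by (meson abs_ge_self mult_right_mono order_trans zero_le_dist)
  then have "\<bar>B\<bar>-lipschitz_on X f"
    by (auto simp: lipschitz_on_def dist_norm)
  then have "continuous_on X f"
    by (rule lipschitz_on_continuous_on)
  moreover have "lip_const X f < \<infinity>"
    using le_less_trans[OF lip_const_le[OF B, of X] ennreal_less_top] by simp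
  ultimately show ?thesis
    using 0 by (simp add: Lip_def)
qed

lemma Lip_outside: "f \<in> Lip X \<Longrightarrow> x \<notin> X \<Longrightarrow> f x = 0"
  by (simp add: Lip_def)

lemma Lip_continuous: "f \<in> Lip X \<Longrightarrow> continuous_on X f"
  by (simp add: Lip_def)

lemma Lip_ext: "f \<in> Lip X \<Longrightarrow> g \<in> Lip X \<Longrightarrow> (\<And>x. x \<in> X \<Longrightarrow> f x = g x) \<Longrightarrow> f = g"
  by (metis Lip_outside ext)

text \<open>\<open>enn2real\<close> sends an infinite supremum to 0, so the bound rests on the
  finiteness contained in \<open>f \<in> Lip X\<close>.\<close>

lemma lip_bound:
  assumes f: "f \<in> Lip X" and x: "x \<in> X" "y \<in> X"
  shows "cmod (f x - f y) \<le> lip X f * dist x y"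
proof (cases "x = y")
  case False
  have "ennreal (cmod (f x - f y) / dist x y) \<le> lip_const X f"
    unfolding lip_const_def using x False by (intro SUP_upper2[of "(x, y)"]) auto
  moreover have "lip_const X f < top"
    using f by (simp add: Lip_def)
  ultimately have "cmod (f x - f y) / dist x y \<le> lip X f"
    unfolding lip_def by (metis divide_nonneg_nonneg enn2real_ennreal enn2real_mono norm_ge_zero zero_le_dist)
  then show ?thesis
    using False by (simp add: divide_le_eq)
qed simp

lemma lip_approx:
  assumes "f \<in> Lip X" and "B < lip X f" and "B \<ge> 0"
  shows "\<exists>x\<in>X. \<exists>y\<in>X. x \<noteq> y \<and> cmod (f x - f y) > B * dist x y"
proof (rule ccontr)
  assume n: "\<not> ?thesis"
  have "cmod (f x - f y) \<le> B * dist x y" if "x \<in> X" "y \<in> X" for x y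
    using n that by (cases "x = y") (auto simp: not_less)
  then show False
    using lip_le[of X f B] assms by auto
qed

lemma Lip_cst: "cst X c \<in> Lip X"
  by (rule LipI[where B = 0]) (auto simp: cst_def)

lemma Lip_zero: "(\<lambda>x. 0) \<in> Lip X"
  by (rule LipI[where B = 0]) auto

lemma Lip_add: "f \<in> Lip X \<Longrightarrow> g \<in> Lip X \<Longrightarrow> (\<lambda>x. f x + g x) \<in> Lip X"
proof (rule LipI[where B = "lip X f + lip X g"])
  fix x y assume *: "f \<in> Lip X" "g \<in> Lip X" "x \<in> X" "y \<in> X"
  have "cmod (f x + g x - (f y + g y)) \<le> cmod (f x - f y) + cmod (g x - g y)"
    by (metis add_diff_add norm_triangle_ineq)
  then show "cmod (f x + g x - (f y + g y)) \<le> (lip X f + lip X g) * dist x y"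
    using lip_bound[OF *(1,3,4)] lip_bound[OF *(2,3,4)] by (simp add: ring_distribs)
qed (auto simp: Lip_outside)

text \<open>Source of the closure properties under scalars, modulus, real and imaginary part. The
  condition \<open>K 0 = 0\<close> respects the convention that functions vanish outside
  \<open>X\<close>.\<close>

lemma Lip_comp:
  assumes f: "f \<in> Lip X" and K: "\<And>z w. cmod (K z - K w) \<le> C * cmod (z - w)" "K 0 = 0" "C \<ge> 0"
  shows "(\<lambda>x. K (f x)) \<in> Lip X" "lip X (\<lambda>x. K (f x)) \<le> C * lip X f"
proof -
  have *: "cmod (K (f x) - K (f y)) \<le> C * lip X f * dist x y" if "x \<in> X" "y \<in> X" for x y
    using K(1)[of "f x" "f y"] mult_left_mono[OF lip_bound[OF f that] K(3)] by (simp add: mult.assoc)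
  show "(\<lambda>x. K (f x)) \<in> Lip X"
    by (rule LipI[OF *]) (auto simp: K(2) Lip_outside[OF f])
  show "lip X (\<lambda>x. K (f x)) \<le> C * lip X f"
    by (rule lip_le[OF *]) (auto simp: K(3) lip_nonneg)
qed

lemma Lip_mult: "f \<in> Lip X \<Longrightarrow> (\<lambda>x. c * f x) \<in> Lip X"
  by (rule Lip_comp[where C = "cmod c"]) (auto simp flip: right_diff_distrib simp: norm_mult)

lemma Lip_minus: "f \<in> Lip X \<Longrightarrow> (\<lambda>x. - f x) \<in> Lip X"
  using Lip_mult[of f X "-1"] by simp

lemma Lip_diff: "f \<in> Lip X \<Longrightarrow> g \<in> Lip X \<Longrightarrow> (\<lambda>x. f x - g x) \<in> Lip X"
  using Lip_add[OF _ Lip_minus, of f X g] by simp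

lemma Lip_cmod: "f \<in> Lip X \<Longrightarrow> (\<lambda>x. complex_of_real (cmod (f x))) \<in> Lip X"
  by (rule Lip_comp[where C = 1])
     (auto simp flip: of_real_diff simp: norm_triangle_ineq3)

lemma Lip_Re: "f \<in> Lip X \<Longrightarrow> (\<lambda>x. complex_of_real (Re (f x))) \<in> Lip X"
  by (rule Lip_comp[where C = 1])
     (auto simp flip: of_real_diff minus_complex.simps simp: abs_Re_le_cmod)

lemma Lip_Im: "f \<in> Lip X \<Longrightarrow> (\<lambda>x. complex_of_real (Im (f x))) \<in> Lip X"
  by (rule Lip_comp[where C = 1])
     (auto simp flip: of_real_diff minus_complex.simps simp: abs_Im_le_cmod)

definition dist_fun :: "'a::metric_space set \<Rightarrow> 'a \<Rightarrow> 'a \<Rightarrow> complex" where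
  "dist_fun X x = (\<lambda>z. if z \<in> X then of_real (dist x z) else 0)"

lemma Lip_dist_fun: "dist_fun X x \<in> Lip X" and lip_dist_fun: "lip X (dist_fun X x) \<le> 1"
proof -
  have *: "cmod (dist_fun X x a - dist_fun X x b) \<le> 1 * dist a b" if "a \<in> X" "b \<in> X" for a b
    using that abs_dist_diff_le[of a x b]
    by (simp add: dist_fun_def dist_commute flip: of_real_diff)
  show "dist_fun X x \<in> Lip X"
    by (rule LipI[OF *]) (auto simp: dist_fun_def)
  show "lip X (dist_fun X x) \<le> 1"
    by (rule lip_le[OF *]) auto
qed

lemma lip_add_le: "f \<in> Lip X \<Longrightarrow> g \<in> Lip X \<Longrightarrow> lip X (\<lambda>x. f x + g x) \<le> lip X f + lip X g"
proof (rule lip_le)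
  fix x y assume *: "f \<in> Lip X" "g \<in> Lip X" "x \<in> X" "y \<in> X"
  have "cmod (f x + g x - (f y + g y)) \<le> cmod (f x - f y) + cmod (g x - g y)"
    by (metis add_diff_add norm_triangle_ineq)
  then show "cmod (f x + g x - (f y + g y)) \<le> (lip X f + lip X g) * dist x y"
    using lip_bound[OF *(1,3,4)] lip_bound[OF *(2,3,4)] by (simp add: ring_distribs)
qed (auto simp: lip_nonneg)

lemma lip_cst [simp]: "lip X (cst X c) = 0"
  using lip_le[of X "cst X c" 0] lip_nonneg[of X "cst X c"] by (auto simp: cst_def)

lemma lip_add_cst: 
  assumes f: "f \<in> Lip X" shows "lip X (\<lambda>x. f x + cst X c x) = lip X f"
proof (rule antisym)
  show "lip X (\<lambda>x. f x + cst X c x) \<le> lip X f"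
    using lip_add_le[OF f Lip_cst[of X c]] by simp
  show "lip X f \<le> lip X (\<lambda>x. f x + cst X c x)"
    using lip_add_le[OF Lip_add[OF f Lip_cst[of X c]] Lip_cst[of X "-c"]] lip_cst[of X "-c"]
    by (simp add: cst_def if_distrib if_distribR cong: if_cong)
qed

section \<open>The supremum norm and the sum norm\<close>

lemma sup_norm_le:
  assumes "\<And>x. x \<in> X \<Longrightarrow> cmod (f x) \<le> B" "B \<ge> 0"
  shows "sup_norm X f \<le> B"
proof -
  have "unorm X f \<le> ennreal B"
    unfolding unorm_def by (rule SUP_least) (auto intro: ennreal_leI assms)
  from enn2real_mono[OF this] show ?thesis
    using assms(2) by (simp add: sup_norm_def)
qed

lemma sup_norm_attained:
  assumes "compact X" "X \<noteq> {}" "f \<in> Lip X"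
  obtains x where "x \<in> X" "cmod (f x) = sup_norm X f" "\<And>z. z \<in> X \<Longrightarrow> cmod (f z) \<le> cmod (f x)"
proof -
  obtain x where x: "x \<in> X" "\<And>z. z \<in> X \<Longrightarrow> cmod (f z) \<le> cmod (f x)"
    using continuous_attains_sup[OF assms(1,2), of "\<lambda>x. cmod (f x)"]
      continuous_on_norm[OF Lip_continuous[OF assms(3)]] by blast
  have "unorm X f = ennreal (cmod (f x))"
    unfolding unorm_def
    by (rule antisym) (auto intro!: SUP_least SUP_upper ennreal_leI x)
  then show ?thesis
    using that[OF x(1) _ x(2)] by (simp add: sup_norm_def)
qed

lemma sup_norm_upper:
  assumes "compact X" "f \<in> Lip X" "x \<in> X"
  shows "cmod (f x) \<le> sup_norm X f"
  by (metis sup_norm_attained assms empty_iff)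

lemma sup_norm_eqI:
  assumes "compact X" "f \<in> Lip X" "x \<in> X" "\<And>z. z \<in> X \<Longrightarrow> cmod (f z) \<le> cmod (f x)"
  shows "sup_norm X f = cmod (f x)"
  by (rule antisym[OF sup_norm_le[OF assms(4)] sup_norm_upper[OF assms(1-3)]]) simp_all

lemma sup_norm_add_le:
  assumes "compact X" "f \<in> Lip X" "g \<in> Lip X"
  shows "sup_norm X (\<lambda>x. f x + g x) \<le> sup_norm X f + sup_norm X g"
  by (rule sup_norm_le)
     (auto intro!: norm_triangle_le add_mono sup_norm_upper assms add_nonneg_nonneg sup_norm_nonneg)

lemma sigma_norm_eq_0D:
  assumes "compact X" "f \<in> Lip X" "sigma_norm X f = 0"
  shows "f = (\<lambda>x. 0)"
proof -
  have "sup_norm X f = 0"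
    using assms(3) sup_norm_nonneg[of X f] lip_nonneg[of X f] by (simp add: sigma_norm_eq)
  then show ?thesis
    using sup_norm_upper[OF assms(1,2)] by (intro Lip_ext[OF assms(2) Lip_zero]) auto
qed

lemma sigma_norm_minus: "sigma_norm X (\<lambda>x. - f x) = sigma_norm X f"
  by (simp add: sigma_norm_def unorm_def lip_const_def norm_minus_commute)

lemma sigma_norm_mult:
  assumes "compact X" "f \<in> Lip X"
  shows "sigma_norm X (\<lambda>x. c * f x) = cmod c * sigma_norm X f"
proof -
  have le: "sigma_norm X (\<lambda>x. c * f x) \<le> cmod c * sigma_norm X f" if "f \<in> Lip X" for c f
  proof -
    have "lip X (\<lambda>x. c * f x) \<le> cmod c * lip X f"
      by (rule Lip_comp(2)[OF that]) (auto simp flip: right_diff_distrib simp: norm_mult)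
    moreover have "sup_norm X (\<lambda>x. c * f x) \<le> cmod c * sup_norm X f"
      by (rule sup_norm_le)
         (auto simp: norm_mult sup_norm_nonneg intro!: mult_left_mono sup_norm_upper assms(1) that)
    ultimately show ?thesis by (simp add: sigma_norm_eq ring_distribs)
  qed
  show ?thesis
  proof (cases "c = 0")
    case True
    then show ?thesis
      using le[OF assms(2), of 0] by (simp add: sigma_norm_eq sup_norm_nonneg lip_nonneg add_nonneg_eq_0_iff antisym)
  next
    case False
    then show ?thesis
      using le[OF assms(2), of c] le[OF Lip_mult[OF assms(2)], of "inverse c" c]
      by (intro antisym) (simp_all add: norm_divide inverse_eq_divide field_simps)
  qed
qed

lemma sigma_norm_cst:
  assumes "compact X" "X \<noteq> {}"
  shows "sigma_norm X (cst X c) = cmod c"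
proof -
  obtain x where "x \<in> X" using assms(2) by blast
  then show ?thesis
    using sup_norm_eqI[OF assms(1) Lip_cst, of x c] unfolding sigma_norm_eq lip_cst by (simp add: cst_def)
qed

lemma sigma_norm_add_le:
  assumes "compact X" "f \<in> Lip X" "g \<in> Lip X"
  shows "sigma_norm X (\<lambda>x. f x + g x) \<le> sigma_norm X f + sigma_norm X g"
  using sup_norm_add_le[OF assms] lip_add_le[OF assms(2,3)] by (simp add: sigma_norm_eq)

text \<open>Additivity gives homogeneity over the integers. With \<open>k\<close> the integer part
  of \<open>n * r\<close>, \<open>n\<close> times the defect
  \<open>A (r *\<^sub>R c) - r *\<^sub>R A c\<close> is the defect for the factor
  \<open>n * r - k\<close>, hence at most \<open>2 * cmod c\<close>. As \<open>n\<close> is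
  arbitrary, the defect vanishes.\<close>

lemma additive_bounded_complex_linear:
  fixes A :: "complex \<Rightarrow> complex"
  assumes add: "\<And>c d. A (c + d) = A c + A d" and bd: "\<And>c. cmod (A c) \<le> cmod c"
  shows "linear A"
proof
  have A0: "A 0 = 0" using bd[of 0] by simp
  have neg: "A (- c) = - A c" for c
    using add[of c "- c"] A0 by (simp add: eq_neg_iff_add_eq_0 add.commute)
  have diff: "A (c - d) = A c - A d" for c d
    using add[of c "- d"] neg by simp
  have nat: "A (of_nat n * c) = of_nat n * A c" for n c
    by (induction n) (auto simp: A0 add ring_distribs)
  have int: "A (of_int k * c) = of_int k * A c" for k c
    by (cases k rule: int_cases2) (auto simp: nat neg)
  show "A (r *\<^sub>R c) = r *\<^sub>R A c" for r c
  proof (rule ccontr)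
    assume "A (r *\<^sub>R c) \<noteq> r *\<^sub>R A c"
    then have pos: "cmod (A (r *\<^sub>R c) - r *\<^sub>R A c) > 0" by simp
    then obtain n :: nat where n: "of_nat n * cmod (A (r *\<^sub>R c) - r *\<^sub>R A c) > 2 * cmod c"
      using reals_Archimedean3 by blast
    define k where "k = \<lfloor>real n * r\<rfloor>"
    have k: "\<bar>real n * r - of_int k\<bar> \<le> 1"
      unfolding k_def by linarith
    have "of_nat n * (A (r *\<^sub>R c) - r *\<^sub>R A c) =
        A (of_nat n * (r *\<^sub>R c) - of_int k * c) - (of_nat n * (r *\<^sub>R A c) - of_int k * A c)"
      unfolding diff nat int by (simp only: ring_distribs) simp
    also have "of_nat n * (r *\<^sub>R c) - of_int k * c = (real n * r - of_int k) *\<^sub>R c"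
      by (simp add: scaleR_conv_of_real ring_distribs mult.assoc)
    also have "of_nat n * (r *\<^sub>R A c) - of_int k * A c = (real n * r - of_int k) *\<^sub>R A c"
      by (simp add: scaleR_conv_of_real ring_distribs mult.assoc)
    finally have "of_nat n * cmod (A (r *\<^sub>R c) - r *\<^sub>R A c) \<le>
        cmod (A ((real n * r - of_int k) *\<^sub>R c)) + cmod ((real n * r - of_int k) *\<^sub>R A c)"
      by (metis norm_triangle_ineq4 norm_mult norm_of_nat)
    also have "\<dots> \<le> \<bar>real n * r - of_int k\<bar> * cmod c + \<bar>real n * r - of_int k\<bar> * cmod c"
      by (intro add_mono) (auto intro: order_trans[OF bd] mult_left_mono bd)
    also have "\<dots> \<le> 2 * cmod c"
      using mult_right_mono[OF k, of "cmod c"] by (simp add: mult.commute)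
    finally show False using n by simp
  qed
qed (rule add)

section \<open>The Mazur-Ulam theorem\<close>

text \<open>For \<open>g\<close> in \<open>W\<close>, also \<open>\<psi> g\<inverse> \<psi> g\<close> is in \<open>W\<close>, and it moves \<open>z\<close> twice as far as \<open>g\<close> does.\<close>

lemma fixed_point_of_reflection_center:
  fixes d :: "'v \<Rightarrow> 'v \<Rightarrow> real"
  assumes nonneg: "\<And>x y. x \<in> M \<Longrightarrow> y \<in> M \<Longrightarrow> d x y \<ge> 0"
    and zeroD: "\<And>x y. x \<in> M \<Longrightarrow> y \<in> M \<Longrightarrow> d x y = 0 \<Longrightarrow> x = y"
    and refl: "\<And>x. x \<in> M \<Longrightarrow> d x x = 0"
    and sym: "\<And>x y. x \<in> M \<Longrightarrow> y \<in> M \<Longrightarrow> d x y = d y x"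
    and tri: "\<And>x y w. x \<in> M \<Longrightarrow> y \<in> M \<Longrightarrow> w \<in> M \<Longrightarrow> d x y \<le> d x w + d w y"
    and \<psi>: "\<And>x. x \<in> M \<Longrightarrow> \<psi> x \<in> M" "\<And>x. x \<in> M \<Longrightarrow> \<psi> (\<psi> x) = x"
      "\<And>x y. x \<in> M \<Longrightarrow> y \<in> M \<Longrightarrow> d (\<psi> x) (\<psi> y) = d x y"
      "\<And>x. x \<in> M \<Longrightarrow> d (\<psi> x) x = 2 * d x z"
    and z: "z \<in> M" and a: "a \<in> M" and b: "b \<in> M" and ab: "\<psi> a = b"
    and h: "bij_betw h M M" "\<And>x y. x \<in> M \<Longrightarrow> y \<in> M \<Longrightarrow> d (h x) (h y) = d x y" "h a = a" "h b = b"
  shows "h z = z"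
proof -
  define W where "W = {g. bij_betw g M M \<and> (\<forall>x\<in>M. \<forall>y\<in>M. d (g x) (g y) = d x y) \<and> g a = a \<and> g b = b}"
  have \<psi>bij: "bij_betw \<psi> M M"
    by (rule bij_betw_byWitness[where f' = \<psi>]) (use \<psi> in auto)
  have \<psi>z: "\<psi> z = z"
    using zeroD[OF \<psi>(1)[OF z] z] \<psi>(4)[OF z] refl[OF z] by simp
  have ba: "\<psi> b = a" using \<psi>(2)[OF a] ab by simp
  have WM: "g x \<in> M" if "g \<in> W" "x \<in> M" for g x
    using that by (auto simp: W_def bij_betw_def)
  have bd: "d (g z) z \<le> 2 * d a z" if g: "g \<in> W" for g
  proof -
    have "d (g z) z \<le> d (g z) a + d a z"
      using tri[OF WM[OF g z] z a] .
    also have "d (g z) a = d (g z) (g a)" using g by (simp add: W_def)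
    also have "\<dots> = d z a" using g z a unfolding W_def by blast
    also have "\<dots> = d a z" by (rule sym[OF z a])
    finally show ?thesis by simp
  qed
  have double: "\<exists>g'\<in>W. d (g' z) z = 2 * d (g z) z" if g: "g \<in> W" for g
  proof -
    define i where "i = inv_into M g"
    have gb: "bij_betw g M M" using g by (simp add: W_def)
    have ib: "bij_betw i M M" unfolding i_def by (rule bij_betw_inv_into[OF gb])
    have iM: "i x \<in> M" if "x \<in> M" for x using ib that by (auto simp: bij_betw_def)
    have gi: "g (i x) = x" if "x \<in> M" for x
      using gb that unfolding i_def by (simp add: bij_betw_inv_into_right)
    have ig: "i (g x) = x" if "x \<in> M" for x
      using gb that unfolding i_def by (simp add: bij_betw_inv_into_left)
    have ia: "i a = a" "i b = b" using ig a b g by (force simp: W_def)+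
    have id: "d (i x) (i y) = d x y" if "x \<in> M" "y \<in> M" for x y
    proof -
      have "d (g (i x)) (g (i y)) = d (i x) (i y)"
        using g iM[OF that(1)] iM[OF that(2)] unfolding W_def by blast
      then show ?thesis using gi that by simp
    qed
    define g' where "g' = (\<lambda>x. \<psi> (i (\<psi> (g x))))"
    have gd: "d (g x) (g y) = d x y" if "x \<in> M" "y \<in> M" for x y
      using g that by (simp add: W_def)
    have "bij_betw (\<psi> \<circ> (i \<circ> (\<psi> \<circ> g))) M M"
      by (rule bij_betw_trans[OF bij_betw_trans[OF bij_betw_trans[OF gb \<psi>bij] ib] \<psi>bij])
    then have "bij_betw g' M M" by (simp add: g'_def comp_def)
    moreover have "d (g' x) (g' y) = d x y" if "x \<in> M" "y \<in> M" for x y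
      unfolding g'_def using that by (simp add: \<psi> id iM WM[OF g] gd)
    moreover have "g' a = a" "g' b = b"
      using g ab ba ia by (auto simp: W_def g'_def)
    ultimately have "g' \<in> W" by (simp add: W_def)
    moreover have "d (g' z) z = 2 * d (g z) z"
    proof -
      have "d (g' z) z = d (\<psi> (i (\<psi> (g z)))) (\<psi> z)" by (simp add: g'_def \<psi>z)
      also have "\<dots> = d (i (\<psi> (g z))) (i (g z))"
        using ig[OF z] by (simp add: \<psi> iM WM[OF g] z)
      also have "\<dots> = d (\<psi> (g z)) (g z)" by (simp add: \<psi> id WM[OF g] z)
      finally show ?thesis by (simp add: \<psi> WM[OF g] z)
    qed
    ultimately show ?thesis by blast
  qed
  have hW: "h \<in> W" using h by (simp add: W_def)
  \<comment> \<open>\<open>S\<close> is bounded and contains the double of each of its elements, so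
    its supremum is at most half of itself and cannot be positive.\<close>
  define S where "S = (\<lambda>g. d (g z) z) ` W"
  have bdd: "bdd_above S" unfolding S_def by (rule bdd_aboveI2[OF bd])
  have "x \<le> Sup S / 2" if "x \<in> S" for x
  proof -
    obtain g where "g \<in> W" "x = d (g z) z" using \<open>x \<in> S\<close> by (auto simp: S_def)
    then obtain g' where "g' \<in> W" "d (g' z) z = 2 * x" using double by blast
    then have "2 * x \<in> S" by (metis S_def imageI)
    then show ?thesis using cSup_upper[OF _ bdd] by fastforce
  qed
  then have "Sup S \<le> Sup S / 2"
    using hW by (intro cSup_least) (auto simp: S_def)
  moreover have "d (h z) z \<le> Sup S"
    using hW by (intro cSup_upper bdd) (auto simp: S_def)
  ultimately have "d (h z) z \<le> 0" by simp
  then show ?thesis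
    using nonneg[OF WM[OF hW z] z] zeroD[OF WM[OF hW z] z] by simp
qed

lemma Lip_midpoint: "f \<in> Lip X \<Longrightarrow> g \<in> Lip X \<Longrightarrow> (\<lambda>x. (f x + g x) / 2) \<in> Lip X"
  using Lip_mult[OF Lip_add, of f X g "1/2"] by simp

lemma Iso_bij:
  assumes "compact X\<^sub>1" "compact X\<^sub>2" and U: "U \<in> Iso (Lip X\<^sub>1) (sigma_norm X\<^sub>1) (Lip X\<^sub>2) (sigma_norm X\<^sub>2)"
  shows "bij_betw U (Lip X\<^sub>1) (Lip X\<^sub>2)"
proof -
  have "inj_on U (Lip X\<^sub>1)"
  proof (rule inj_onI)
    fix f g assume fg: "f \<in> Lip X\<^sub>1" "g \<in> Lip X\<^sub>1" "U f = U g"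
    have "sigma_norm X\<^sub>2 (\<lambda>x. 0) = 0"
      using sigma_norm_mult[OF assms(2) Lip_zero, of 0] by simp
    then have "sigma_norm X\<^sub>1 (f - g) = 0"
      using U fg by (force simp: Iso_def fun_diff_def)
    then have "(\<lambda>x. f x - g x) = (\<lambda>x. 0)"
      using sigma_norm_eq_0D[OF assms(1) Lip_diff[OF fg(1,2)]] by (simp add: fun_diff_def)
    then show "f = g" by (metis eq_iff_diff_eq_0 ext)
  qed
  then show ?thesis using U by (simp add: Iso_def bij_betw_def)
qed

text \<open>Let \<open>r1\<close> and \<open>r2\<close> be the reflections in the midpoints of
  \<open>f\<close>, \<open>g\<close> and of \<open>U f\<close>, \<open>U g\<close>, and
  \<open>i\<close> the inverse of \<open>U\<close>. The isometry
  \<open>r1 \<circ> i \<circ> r2 \<circ> U\<close> fixes \<open>f\<close> and \<open>g\<close>,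
  hence also their midpoint by \<open>fixed_point_of_reflection_center\<close>. So \<open>r2\<close>
  fixes the image of the midpoint, and the only fixed point of \<open>r2\<close> is its
  center.\<close>

lemma mazur_ulam_Lip:
  assumes X: "compact X\<^sub>1" "compact X\<^sub>2"
    and U: "U \<in> Iso (Lip X\<^sub>1) (sigma_norm X\<^sub>1) (Lip X\<^sub>2) (sigma_norm X\<^sub>2)"
    and f: "f \<in> Lip X\<^sub>1" "g \<in> Lip X\<^sub>1"
  shows "U (\<lambda>x. (f x + g x) / 2) = (\<lambda>y. (U f y + U g y) / 2)"
proof -
  let ?z = "\<lambda>x. (f x + g x) / 2"
  have bij: "bij_betw U (Lip X\<^sub>1) (Lip X\<^sub>2)" by (rule Iso_bij[OF X U])
  define i where "i = inv_into (Lip X\<^sub>1) U"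
  have ib: "bij_betw i (Lip X\<^sub>2) (Lip X\<^sub>1)" unfolding i_def by (rule bij_betw_inv_into[OF bij])
  have Ui: "U (i k) = k" if "k \<in> Lip X\<^sub>2" for k
    using bij that unfolding i_def by (simp add: bij_betw_inv_into_right)
  have iU: "i (U k) = k" if "k \<in> Lip X\<^sub>1" for k
    using bij that unfolding i_def by (simp add: bij_betw_inv_into_left)
  have UM: "U k \<in> Lip X\<^sub>2" if "k \<in> Lip X\<^sub>1" for k using bij that by (auto simp: bij_betw_def)
  have iM: "i k \<in> Lip X\<^sub>1" if "k \<in> Lip X\<^sub>2" for k using ib that by (auto simp: bij_betw_def)
  have Ud: "sigma_norm X\<^sub>2 (U k - U l) = sigma_norm X\<^sub>1 (k - l)" if "k \<in> Lip X\<^sub>1" "l \<in> Lip X\<^sub>1" for k l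
    using U that by (simp add: Iso_def)
  have id: "sigma_norm X\<^sub>1 (i k - i l) = sigma_norm X\<^sub>2 (k - l)" if "k \<in> Lip X\<^sub>2" "l \<in> Lip X\<^sub>2" for k l
    using Ud[OF iM[OF that(1)] iM[OF that(2)]] Ui that by simp
  define r1 where "r1 = (\<lambda>k x. f x + g x - k x)"
  define r2 where "r2 = (\<lambda>k x. U f x + U g x - k x)"
  have r1: "r1 k \<in> Lip X\<^sub>1" "r1 (r1 k) = k" "r1 k - r1 l = (\<lambda>x. - ((k - l) x))" if "k \<in> Lip X\<^sub>1" for k l
    using that f by (auto simp: r1_def fun_eq_iff intro!: Lip_add Lip_diff)
  have r2: "r2 k \<in> Lip X\<^sub>2" "r2 (r2 k) = k" "r2 k - r2 l = (\<lambda>x. - ((k - l) x))" if "k \<in> Lip X\<^sub>2" for k l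
    using that f by (auto simp: r2_def fun_eq_iff intro!: Lip_add Lip_diff UM)
  have scale: "sigma_norm X (\<lambda>x. a x + b x - k x - k x) = 2 * sigma_norm X (\<lambda>x. k x - (a x + b x) / 2)"
    if "compact X" "a \<in> Lip X" "b \<in> Lip X" "k \<in> Lip X" for X :: "'c::metric_space set" and a b k
  proof -
    have "(\<lambda>x. a x + b x - k x - k x) = (\<lambda>x. (-2) * (k x - (a x + b x) / 2))"
      by (auto simp: field_simps)
    then show ?thesis
      using sigma_norm_mult[OF that(1) Lip_diff[OF that(4) Lip_midpoint[OF that(2,3)]], of "-2"] by simp
  qed
  have "bij_betw (r1 \<circ> (i \<circ> (r2 \<circ> U))) (Lip X\<^sub>1) (Lip X\<^sub>1)"
  proof (intro bij_betw_trans)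
    show "bij_betw r1 (Lip X\<^sub>1) (Lip X\<^sub>1)"
      by (rule bij_betw_byWitness[where f' = r1]) (use r1 in auto)
    show "bij_betw r2 (Lip X\<^sub>2) (Lip X\<^sub>2)"
      by (rule bij_betw_byWitness[where f' = r2]) (use r2 in auto)
  qed (fact ib bij)+
  then have hb: "bij_betw (\<lambda>k. r1 (i (r2 (U k)))) (Lip X\<^sub>1) (Lip X\<^sub>1)"
    by (simp add: comp_def)
  have z: "?z \<in> Lip X\<^sub>1" by (rule Lip_midpoint[OF f])
  have "r1 (i (r2 (U ?z))) = ?z"
  proof (rule fixed_point_of_reflection_center[where M = "Lip X\<^sub>1" and \<psi> = r1
        and d = "\<lambda>k l. sigma_norm X\<^sub>1 (k - l)" and a = f and b = g])
    show "sigma_norm X\<^sub>1 (k - l) \<ge> 0" for k l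
      by (simp add: sigma_norm_eq sup_norm_nonneg lip_nonneg)
    show "k = l" if "k \<in> Lip X\<^sub>1" "l \<in> Lip X\<^sub>1" "sigma_norm X\<^sub>1 (k - l) = 0" for k l
      using sigma_norm_eq_0D[OF X(1) Lip_diff[OF that(1,2)]] that(3)
      by (simp add: fun_diff_def fun_eq_iff)
    show "sigma_norm X\<^sub>1 (k - k) = 0" for k
      using sigma_norm_mult[OF X(1) Lip_zero, of 0] by (simp add: fun_diff_def)
    show "sigma_norm X\<^sub>1 (k - l) = sigma_norm X\<^sub>1 (l - k)" for k l
      using sigma_norm_minus[of X\<^sub>1 "k - l"] by (simp add: fun_diff_def)
    show "sigma_norm X\<^sub>1 (k - l) \<le> sigma_norm X\<^sub>1 (k - m) + sigma_norm X\<^sub>1 (m - l)"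
      if "k \<in> Lip X\<^sub>1" "l \<in> Lip X\<^sub>1" "m \<in> Lip X\<^sub>1" for k l m
      using sigma_norm_add_le[OF X(1) Lip_diff[OF that(1,3)] Lip_diff[OF that(3,2)]]
      by (simp add: fun_diff_def)
    show "sigma_norm X\<^sub>1 (r1 k - r1 l) = sigma_norm X\<^sub>1 (k - l)" if "k \<in> Lip X\<^sub>1" for k l
      using r1(3)[OF that] sigma_norm_minus[of X\<^sub>1 "k - l"] by simp
    show "sigma_norm X\<^sub>1 (r1 k - k) = 2 * sigma_norm X\<^sub>1 (k - ?z)" if "k \<in> Lip X\<^sub>1" for k
      using scale[OF X(1) f that] by (simp add: fun_diff_def r1_def)
    show "sigma_norm X\<^sub>1 (r1 (i (r2 (U k))) - r1 (i (r2 (U l)))) = sigma_norm X\<^sub>1 (k - l)"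
      if "k \<in> Lip X\<^sub>1" "l \<in> Lip X\<^sub>1" for k l
      using that sigma_norm_minus[of X\<^sub>2 "U k - U l"] sigma_norm_minus[of X\<^sub>1 "i (r2 (U k)) - i (r2 (U l))"]
      by (simp add: r1 r2 iM UM id Ud)
    have "r2 (U f) = U g" "r2 (U g) = U f" "r1 f = g" "r1 g = f"
      by (auto simp: r1_def r2_def)
    then show "r1 (i (r2 (U f))) = f" "r1 (i (r2 (U g))) = g" "r1 f = g"
      using f by (simp_all add: iU)
  qed (use r1 z f hb in auto)
  then have "i (r2 (U ?z)) = r1 ?z"
    using r1(2)[OF iM[OF r2(1)[OF UM[OF z]]]] by simp
  also have "r1 ?z = ?z" by (simp add: r1_def field_simps)
  finally have "r2 (U ?z) = U ?z"
    using Ui[OF r2(1)[OF UM[OF z]]] by simp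
  then have "U f y + U g y - U ?z y = U ?z y" for y
    by (metis r2_def)
  then show ?thesis
    by (simp add: fun_eq_iff field_simps)
qed

section \<open>Strict convexity\<close>

text \<open>The net is a sequence indexed by \<open>i < n\<close>, repetitions allowed, so that its
  image under an isometry is a net with the same number \<open>n\<close>.\<close>

lemma finite_cover_dense:
  fixes X :: "'a::metric_space set"
  assumes "compact X" "e > 0"
  shows "\<exists>n (s :: nat \<Rightarrow> 'a). (\<forall>i<n. s i \<in> X) \<and> (\<forall>x\<in>X. \<exists>i<n. dist x (s i) \<le> e)"
proof -
  obtain k where k: "finite k" "k \<subseteq> X" "X \<subseteq> (\<Union>x\<in>k. ball x e)"
  proof (rule compactE_image[OF assms(1), of X "\<lambda>x. ball x e"])
    show "X \<subseteq> (\<Union>x\<in>X. ball x e)" using assms(2) by auto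
  qed auto
  obtain xs where xs: "set xs = k"
    using finite_list[OF k(1)] by auto
  define n and s where "n = length xs" and "s = (\<lambda>i. xs ! i)"
  have s: "k = s ` {i. i < n}"
    by (auto simp: n_def s_def set_conv_nth simp flip: xs)
  have "\<forall>i<n. s i \<in> X"
    using k(2) unfolding s by blast
  moreover have "\<exists>i<n. dist x (s i) \<le> e" if x: "x \<in> X" for x
  proof -
    obtain z where "z \<in> k" "dist z x < e"
      using subsetD[OF k(3) x] by (auto simp only: UN_iff mem_ball)
    then show ?thesis
      unfolding s by (auto simp: dist_commute intro: less_imp_le)
  qed
  ultimately show ?thesis by metis
qed

text \<open>
  The supremum of \<open>\<Sum>i<n. (cmod (h (s i)))\<^sup>2\<close> over all \<open>n\<close>-point \<open>e\<close>-nets \<open>s\<close> is invariant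
  under isometries. The parallelogram law at a nearly extremal net makes \<open>u - v\<close> small on it.
\<close>

lemma strict_convexity:
  fixes h :: "'a::metric_space \<Rightarrow> complex" and u v :: "'b::metric_space \<Rightarrow> complex"
  assumes X: "compact X" and h: "h \<in> Lip X" and u: "u \<in> Lip Y" and v: "v \<in> Lip Y"
    and p: "isometry_onto p Y X" "\<And>y. y \<in> Y \<Longrightarrow> cmod (u y) = cmod (h (p y))"
    and q: "isometry_onto q Y X" "\<And>y. y \<in> Y \<Longrightarrow> cmod (v y) = cmod (h (q y))"
    and r: "isometry_onto r Y X" "\<And>y. y \<in> Y \<Longrightarrow> cmod (u y + v y) = 2 * cmod (h (r y))"
  shows "u = v"
proof (rule Lip_ext[OF u v])
  fix y assume y: "y \<in> Y"
  define C where "C = lip Y (\<lambda>y. u y - v y)"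
  have "cmod (u y - v y) \<le> 0 + e" if e: "e > 0" for e
  proof -
    \<comment> \<open>A bound \<open>d\<close> at a net point and the variation \<open>C * d\<close>
      of \<open>u - v\<close> up to \<open>y\<close> add up to at most \<open>e\<close>.\<close>
    define d where "d = e / (2 + C)"
    have C0: "C \<ge> 0" by (simp add: C_def lip_nonneg)
    have d: "d > 0" using e C0 by (simp add: d_def)
    obtain n and s0 :: "nat \<Rightarrow> 'a" where s0: "\<forall>i<n. s0 i \<in> X" "\<forall>x\<in>X. \<exists>i<n. dist x (s0 i) \<le> d"
      using finite_cover_dense[OF X d] by metis
    define N where "N = {s. (\<forall>i<n. s i \<in> X) \<and> (\<forall>x\<in>X. \<exists>i<n. dist x (s i) \<le> d)}"
    define S where "S = (\<lambda>s. \<Sum>i<n. (cmod (h (s i)))\<^sup>2) ` N"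
    have ne: "S \<noteq> {}" using s0 by (auto simp: S_def N_def)
    have bdd: "bdd_above S"
      unfolding S_def
    proof (rule bdd_aboveI2)
      fix s assume "s \<in> N"
      then show "(\<Sum>i<n. (cmod (h (s i)))\<^sup>2) \<le> (\<Sum>i<n. (sup_norm X h)\<^sup>2)"
        by (intro sum_mono power_mono sup_norm_upper X h) (auto simp: N_def)
    qed
    \<comment> \<open>The slack \<open>d\<^sup>2 / 4\<close> becomes \<open>d\<^sup>2\<close>
      through the factor 4 in the parallelogram law.\<close>
    obtain s where s: "s \<in> N" "(\<Sum>i<n. (cmod (h (s i)))\<^sup>2) > Sup S - d\<^sup>2 / 4"
      using less_cSupD[OF ne, of "Sup S - d\<^sup>2 / 4"] d by (auto simp: S_def)
    \<comment> \<open>Pulling \<open>s\<close> back along \<open>r\<close> gives a net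
      \<open>t\<close> of \<open>Y\<close>, whose images under \<open>p\<close> and \<open>q\<close>
      lie in \<open>N\<close> again and so cannot exceed the supremum.\<close>
    have "\<forall>i<n. \<exists>y\<in>Y. r y = s i"
      using s(1) r(1) by (auto simp: N_def isometry_onto_def image_iff) metis
    then obtain t where t: "\<And>i. i < n \<Longrightarrow> t i \<in> Y" "\<And>i. i < n \<Longrightarrow> r (t i) = s i"
      by metis
    have tnet: "\<exists>i<n. dist y (t i) \<le> d" if "y \<in> Y" for y
    proof -
      have "r y \<in> X" using r(1) that by (auto simp: isometry_onto_def)
      then obtain i where "i < n" "dist (r y) (s i) \<le> d" using s(1) by (auto simp: N_def)
      then show ?thesis using r(1) t that by (metis isometry_onto_def)
    qed
    have le: "(\<Sum>i<n. (cmod (w (t i)))\<^sup>2) \<le> Sup S"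
      if "isometry_onto p Y X" "\<And>y. y \<in> Y \<Longrightarrow> cmod (w y) = cmod (h (p y))" for w p
    proof -
      have "\<exists>i<n. dist x (p (t i)) \<le> d" if "x \<in> X" for x
      proof -
        obtain y where "y \<in> Y" "x = p y"
          using \<open>isometry_onto p Y X\<close> \<open>x \<in> X\<close> unfolding isometry_onto_def by blast
        then show ?thesis
          using tnet[of y] \<open>isometry_onto p Y X\<close> t(1) by (metis isometry_onto_def)
      qed
      then have "(\<lambda>i. p (t i)) \<in> N"
        using that(1) t(1) by (auto simp: N_def isometry_onto_def)
      then have "(\<Sum>i<n. (cmod (h (p (t i))))\<^sup>2) \<le> Sup S"
        by (intro cSup_upper bdd) (auto simp: S_def)
      then show ?thesis using that(2) t(1) by simp
    qed
    have par: "(cmod (a - b))\<^sup>2 = 2 * (cmod a)\<^sup>2 + 2 * (cmod b)\<^sup>2 - (cmod (a + b))\<^sup>2" for a b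
      by (simp add: cmod_power2) algebra
    have uv: "(\<Sum>i<n. (cmod (u (t i) + v (t i)))\<^sup>2) = 4 * (\<Sum>i<n. (cmod (h (s i)))\<^sup>2)"
      unfolding sum_distrib_left using r(2) t by (intro sum.cong) (auto simp: power_mult_distrib)
    have "(\<Sum>i<n. (cmod (u (t i) - v (t i)))\<^sup>2) =
        2 * (\<Sum>i<n. (cmod (u (t i)))\<^sup>2) + 2 * (\<Sum>i<n. (cmod (v (t i)))\<^sup>2) - 4 * (\<Sum>i<n. (cmod (h (s i)))\<^sup>2)"
      unfolding uv[symmetric] par by (simp add: sum.distrib sum_subtractf sum_distrib_left)
    also have "\<dots> \<le> d\<^sup>2"
      using le[OF p] le[OF q] s(2) by simp
    finally have sum: "(\<Sum>i<n. (cmod (u (t i) - v (t i)))\<^sup>2) \<le> d\<^sup>2" .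
    obtain i where i: "i < n" "dist y (t i) \<le> d" using tnet[OF y] by blast
    have "(cmod (u (t i) - v (t i)))\<^sup>2 \<le> d\<^sup>2"
      using i(1) sum by (intro order_trans[OF member_le_sum[of i "{..<n}"] sum]) auto
    then have "cmod (u (t i) - v (t i)) \<le> d"
      using d by (simp add: power2_le_iff_abs_le)
    moreover have "cmod ((u y - v y) - (u (t i) - v (t i))) \<le> C * d"
      using lip_bound[OF Lip_diff[OF u v] y t(1)[OF i(1)]] mult_left_mono[OF i(2) C0]
      by (simp add: C_def)
    moreover have "cmod (u y - v y) \<le> cmod ((u y - v y) - (u (t i) - v (t i))) + cmod (u (t i) - v (t i))"
      by (metis diff_add_cancel norm_triangle_ineq)
    moreover have "d + C * d \<le> e"
    proof -
      have "(2 + C) * d = e" using C0 by (simp add: d_def)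
      then show ?thesis using d by (simp add: ring_distribs)
    qed
    ultimately show ?thesis by simp
  qed
  then have "cmod (u y - v y) \<le> 0" by (rule field_le_epsilon)
  then show "u y = v y" by simp
qed

section \<open>Images of constants\<close>

lemma cmod_add_eqD:
  assumes "cmod (a + b) = cmod a + cmod b" "a \<noteq> 0"
  shows "b = (a / of_real (cmod a)) * of_real (cmod b)"
proof -
  have "cmod a *\<^sub>R b = cmod b *\<^sub>R a"
    using assms(1) norm_triangle_eq by blast
  then have "of_real (cmod a) * b = of_real (cmod b) * a"
    by (simp add: scaleR_conv_of_real)
  then show ?thesis
    using assms(2) by (simp add: field_simps)
qed

lemma sgn_unimodular: "z \<noteq> 0 \<Longrightarrow> cmod (z / of_real (cmod z)) = 1"
  by (simp add: norm_divide)

text \<open>Chords of a circle in a direction close to that of its base points are long.\<close>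

lemma chord_estimate:
  assumes "cmod a = m" "cmod b = m" "cmod w = 1"
    and "cmod (a - of_real m * w) \<le> s" "cmod (b - of_real m * w) \<le> s"
    and "Re (cnj w * (a - b)) \<ge> t" "cmod (a - b) \<le> l"
  shows "m * t \<le> s * l"
proof -
  \<comment> \<open>For points on a circle around 0 the sum is orthogonal to the difference, while
    here \<open>a + b\<close> is close to \<open>2 * m * w\<close>.\<close>
  have sq: "Re (cnj (a + b) * (a - b)) = 0"
  proof -
    have "Re (cnj (a + b) * (a - b)) = (cmod a)\<^sup>2 - (cmod b)\<^sup>2"
      by (simp only: cmod_power2) (simp add: algebra_simps power2_eq_square)
    then show ?thesis using assms(1,2) by simp
  qed
  define d where "d = (a - of_real m * w) + (b - of_real m * w)"
  have "a + b = of_real (2 * m) * w + d" by (simp add: d_def)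
  then have "0 = Re ((of_real (2 * m) * cnj w + cnj d) * (a - b))"
    using sq by simp
  also have "\<dots> = 2 * m * Re (cnj w * (a - b)) + Re (cnj d * (a - b))"
    by (simp add: algebra_simps)
  finally have "2 * m * Re (cnj w * (a - b)) = - Re (cnj d * (a - b))" by simp
  also have "\<dots> \<le> cmod (cnj d * (a - b))"
    using abs_Re_le_cmod[of "cnj d * (a - b)"] by linarith
  also have "\<dots> = cmod d * cmod (a - b)" by (simp add: norm_mult)
  also have "\<dots> \<le> (s + s) * l"
  proof (rule mult_mono)
    show "cmod d \<le> s + s" unfolding d_def by (rule norm_triangle_le[OF add_mono[OF assms(4,5)]])
    show "0 \<le> s + s" using norm_ge_zero[of "a - of_real m * w"] assms(4) by linarith
  qed (use assms(7) in auto)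
  finally have "2 * m * Re (cnj w * (a - b)) \<le> 2 * (s * l)" by simp
  moreover have "m * t \<le> m * Re (cnj w * (a - b))"
    using assms(1,6) by (intro mult_left_mono) auto
  ultimately show ?thesis by simp
qed

text \<open>\<open>p\<close> and \<open>q\<close> are difference quotients bounded by \<open>1\<close> and \<open>L\<close> whose sum is almost maximal.\<close>

lemma aligned_estimate:
  assumes p: "\<bar>p\<bar> \<le> 1" and q: "cmod q \<le> L" and w: "cmod w = 1" and L: "L > 0"
    and big: "cmod (w * of_real p + q) \<ge> 1 + L - L / (2 * (1 + L))"
  shows "p * Re (cnj w * q) \<ge> L / 2"
proof -
  have "(cmod (w * of_real p + q))\<^sup>2 = p\<^sup>2 + 2 * (p * Re (cnj w * q)) + (cmod q)\<^sup>2"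
  proof -
    have "(cmod w)\<^sup>2 = 1" using w by simp
    then have "(Re w)\<^sup>2 + (Im w)\<^sup>2 = 1" by (simp only: cmod_power2)
    moreover have "(cmod (w * of_real p + q))\<^sup>2
        = ((Re w)\<^sup>2 + (Im w)\<^sup>2) * p\<^sup>2 + 2 * (p * Re (cnj w * q)) + (cmod q)\<^sup>2"
      by (simp only: cmod_power2) (simp add: algebra_simps power2_eq_square)
    ultimately show ?thesis by simp
  qed
  moreover have "p\<^sup>2 \<le> 1" using p by (simp add: abs_square_le_1)
  moreover have "(cmod q)\<^sup>2 \<le> L\<^sup>2" using q by (simp add: power_mono)
  moreover have "(1 + L)\<^sup>2 - L \<le> (cmod (w * of_real p + q))\<^sup>2"
  proof -
    \<comment> \<open>The tolerance \<open>L / (2 * (1 + L))\<close> lowers the square by at most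
      \<open>L\<close>, which is half of the mixed term \<open>2 * L\<close>; the other half remains
      for the inner product.\<close>
    have "(1 + L)\<^sup>2 - L \<le> (1 + L - L / (2 * (1 + L)))\<^sup>2"
    proof -
      have e: "(1 + L) * (L / (2 * (1 + L))) = L / 2" using L by (simp add: field_simps)
      have "(1 + L - L / (2 * (1 + L)))\<^sup>2 = (1 + L)\<^sup>2 - 2 * ((1 + L) * (L / (2 * (1 + L)))) + (L / (2 * (1 + L)))\<^sup>2"
        by (simp only: power2_diff)
      then show ?thesis unfolding e by simp
    qed
    also have "\<dots> \<le> (cmod (w * of_real p + q))\<^sup>2"
    proof (rule power_mono[OF big])
      have "L / (2 * (1 + L)) \<le> 1" using L by (simp add: divide_le_eq)
      then show "0 \<le> 1 + L - L / (2 * (1 + L))" using L by linarith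
    qed
    finally show ?thesis .
  qed
  moreover have "(1 + L)\<^sup>2 = 1 + 2 * L + L\<^sup>2" by (simp add: power2_sum)
  ultimately show ?thesis by linarith
qed

section \<open>Additive surjective isometries and their values at constants\<close>

locale additive_isometry =
  fixes X\<^sub>1 :: "'a::metric_space set" and X\<^sub>2 :: "'b::metric_space set"
    and V :: "('a \<Rightarrow> complex) \<Rightarrow> 'b \<Rightarrow> complex"
  assumes compact: "compact X\<^sub>1" "compact X\<^sub>2" and nonempty: "X\<^sub>1 \<noteq> {}" "X\<^sub>2 \<noteq> {}"
    and onto: "V ` Lip X\<^sub>1 = Lip X\<^sub>2"
    and add: "\<And>f g. f \<in> Lip X\<^sub>1 \<Longrightarrow> g \<in> Lip X\<^sub>1 \<Longrightarrow> V (\<lambda>x. f x + g x) = (\<lambda>y. V f y + V g y)"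
    and isometric: "\<And>f. f \<in> Lip X\<^sub>1 \<Longrightarrow> sigma_norm X\<^sub>2 (V f) = sigma_norm X\<^sub>1 f"
begin

lemma V_Lip: "f \<in> Lip X\<^sub>1 \<Longrightarrow> V f \<in> Lip X\<^sub>2"
  using onto by blast

lemma V_zero: "V (\<lambda>x. 0) = (\<lambda>y. 0)"
  using add[OF Lip_zero Lip_zero] by (simp add: fun_eq_iff)

lemma V_minus:
  assumes f: "f \<in> Lip X\<^sub>1" shows "V (\<lambda>x. - f x) = (\<lambda>y. - V f y)"
proof -
  have "V (\<lambda>x. f x + - f x) = (\<lambda>y. V f y + V (\<lambda>x. - f x) y)"
    by (rule add[OF f Lip_minus[OF f]])
  then show ?thesis by (simp add: V_zero fun_eq_iff eq_neg_iff_add_eq_0 add.commute)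
qed

lemma V_diff:
  assumes "f \<in> Lip X\<^sub>1" "g \<in> Lip X\<^sub>1" shows "V (\<lambda>x. f x - g x) = (\<lambda>y. V f y - V g y)"
  using add[OF assms(1) Lip_minus[OF assms(2)]] V_minus[OF assms(2)] by simp

lemma V_inj: "inj_on V (Lip X\<^sub>1)"
proof (rule inj_onI)
  fix f g assume fg: "f \<in> Lip X\<^sub>1" "g \<in> Lip X\<^sub>1" "V f = V g"
  have "V (\<lambda>x. f x - g x) = (\<lambda>x. 0)" using V_diff[OF fg(1,2)] fg(3) by simp
  then have "sigma_norm X\<^sub>1 (\<lambda>x. f x - g x) = sigma_norm X\<^sub>2 (\<lambda>x. 0)"
    using isometric[OF Lip_diff[OF fg(1,2)]] by simp
  also have "\<dots> = sigma_norm X\<^sub>1 (\<lambda>x. 0)" using isometric[OF Lip_zero] V_zero by simp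
  also have "\<dots> = 0" using sigma_norm_mult[OF compact(1) Lip_zero, of 0] by simp
  finally have "(\<lambda>x. f x - g x) = (\<lambda>x. 0)"
    by (rule sigma_norm_eq_0D[OF compact(1) Lip_diff[OF fg(1,2)]])
  then show "f = g" by (metis eq_iff_diff_eq_0 ext)
qed

definition Vinv :: "('b \<Rightarrow> complex) \<Rightarrow> 'a \<Rightarrow> complex" where
  "Vinv = inv_into (Lip X\<^sub>1) V"

lemma Vinv_Lip: "g \<in> Lip X\<^sub>2 \<Longrightarrow> Vinv g \<in> Lip X\<^sub>1"
  unfolding Vinv_def using onto inv_into_into by metis

lemma V_Vinv: "g \<in> Lip X\<^sub>2 \<Longrightarrow> V (Vinv g) = g"
  unfolding Vinv_def using onto f_inv_into_f by metis

lemma Vinv_V: "f \<in> Lip X\<^sub>1 \<Longrightarrow> Vinv (V f) = f"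
  unfolding Vinv_def by (rule inv_into_f_f[OF V_inj])

text \<open>Makes every result of the locale available for the inverse as well.\<close>

lemma inverse_isometry: "additive_isometry X\<^sub>2 X\<^sub>1 Vinv"
proof
  show "Vinv ` Lip X\<^sub>2 = Lip X\<^sub>1"
    using Vinv_Lip Vinv_V V_Lip by (auto simp: image_iff) metis
  fix f g assume f: "f \<in> Lip X\<^sub>2"
  show "sigma_norm X\<^sub>1 (Vinv f) = sigma_norm X\<^sub>2 f"
    using isometric[OF Vinv_Lip[OF f]] V_Vinv[OF f] by simp
  assume g: "g \<in> Lip X\<^sub>2"
  have "Vinv (V (\<lambda>x. Vinv f x + Vinv g x)) = (\<lambda>x. Vinv f x + Vinv g x)"
    by (rule Vinv_V[OF Lip_add[OF Vinv_Lip[OF f] Vinv_Lip[OF g]]])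
  then show "Vinv (\<lambda>x. f x + g x) = (\<lambda>y. Vinv f y + Vinv g y)"
    by (simp add: add[OF Vinv_Lip[OF f] Vinv_Lip[OF g]] V_Vinv f g)
qed (use compact nonempty in auto)

definition E :: "complex \<Rightarrow> 'b \<Rightarrow> complex" where
  "E c = V (cst X\<^sub>1 c)"

lemma E_Lip: "E c \<in> Lip X\<^sub>2"
  unfolding E_def by (rule V_Lip[OF Lip_cst])

lemma sigma_norm_E: "sigma_norm X\<^sub>2 (E c) = cmod c"
  unfolding E_def by (simp add: isometric Lip_cst sigma_norm_cst compact nonempty)

lemma linear_E: "linear (\<lambda>c. E c y)"
proof (rule additive_bounded_complex_linear)
  show "E (c + d) y = E c y + E d y" for c d
  proof -
    have "cst X\<^sub>1 (c + d) = (\<lambda>x. cst X\<^sub>1 c x + cst X\<^sub>1 d x)" by (auto simp: cst_def)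
    then show ?thesis unfolding E_def using add[OF Lip_cst Lip_cst] by simp
  qed
  show "cmod (E c y) \<le> cmod c" for c
  proof (cases "y \<in> X\<^sub>2")
    case True
    then show ?thesis
      using sup_norm_upper[OF compact(2) E_Lip True, of c] sigma_norm_E[of c] lip_nonneg[of X\<^sub>2 "E c"]
      by (simp add: sigma_norm_eq)
  qed (simp add: Lip_outside[OF E_Lip])
qed

text \<open>For the preimage of \<open>g\<close> take \<open>c\<close> in the direction of its value
  at a point of maximal modulus. Adding this constant raises the supremum norm by 1 and keeps the
  Lipschitz constant; additivity transports the identity to \<open>g\<close>.\<close>

lemma constant_direction:
  assumes g: "g \<in> Lip X\<^sub>2"
  obtains c where "cmod c = 1" "sigma_norm X\<^sub>2 (\<lambda>y. g y + E c y) = sigma_norm X\<^sub>2 g + 1"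
proof -
  let ?f = "Vinv g"
  have f: "?f \<in> Lip X\<^sub>1" by (rule Vinv_Lip[OF g])
  obtain x where x: "x \<in> X\<^sub>1" "cmod (?f x) = sup_norm X\<^sub>1 ?f"
      "\<And>z. z \<in> X\<^sub>1 \<Longrightarrow> cmod (?f z) \<le> cmod (?f x)"
    using sup_norm_attained[OF compact(1) nonempty(1) f] by blast
  \<comment> \<open>If the maximum is 0, any unimodular number does.\<close>
  define c where "c = (if ?f x = 0 then 1 else ?f x / of_real (cmod (?f x)))"
  have c: "cmod c = 1" by (simp add: c_def sgn_unimodular)
  have fx: "cmod (?f x + c) = cmod (?f x) + 1"
  proof (cases "?f x = 0")
    case False
    then have "?f x + c = of_real (cmod (?f x) + 1) * c"
      by (simp add: c_def field_simps)
    then have "cmod (?f x + c) = \<bar>cmod (?f x) + 1\<bar> * cmod c"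
      by (simp only: norm_mult norm_of_real)
    then show ?thesis using c by simp
  qed (simp add: c_def)
  have "sup_norm X\<^sub>1 (\<lambda>x. ?f x + cst X\<^sub>1 c x) = cmod (?f x + cst X\<^sub>1 c x)"
  proof (rule sup_norm_eqI[OF compact(1) Lip_add[OF f Lip_cst] x(1)])
    fix z assume z: "z \<in> X\<^sub>1"
    have "cmod (?f z + c) \<le> cmod (?f z) + cmod c" by (rule norm_triangle_ineq)
    then show "cmod (?f z + cst X\<^sub>1 c z) \<le> cmod (?f x + cst X\<^sub>1 c x)"
      using z x fx c by (simp add: cst_def) (smt (verit) x(3))
  qed
  then have "sigma_norm X\<^sub>1 (\<lambda>x. ?f x + cst X\<^sub>1 c x) = sigma_norm X\<^sub>1 ?f + 1"
    using x(1,2) fx lip_add_cst[OF f, of c] by (simp add: sigma_norm_eq cst_def)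
  then have "sigma_norm X\<^sub>2 (\<lambda>y. g y + E c y) = sigma_norm X\<^sub>2 g + 1"
    using isometric[OF Lip_add[OF f Lip_cst], of c] isometric[OF f] add[OF f Lip_cst, of c]
    by (simp add: V_Vinv[OF g] E_def)
  then show ?thesis using c that by blast
qed

text \<open>By \<open>constant_direction\<close> the triangle inequalities for
  \<open>sup_norm\<close> and for \<open>lip\<close> are both equalities. The supremum norm of the
  sum can then be attained only at the peak \<open>x\<close>, and equality in the triangle
  inequality there aligns \<open>E c x\<close> with \<open>f x\<close>.\<close>

lemma peak_alignment:
  assumes f: "f \<in> Lip X\<^sub>2" and x: "x \<in> X\<^sub>2" and fx: "f x \<noteq> 0"
    and peak: "\<And>z. z \<in> X\<^sub>2 \<Longrightarrow> z \<noteq> x \<Longrightarrow> cmod (f z) < cmod (f x)"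
  obtains c where "cmod c = 1" "E c x = f x / of_real (cmod (f x)) * of_real (sup_norm X\<^sub>2 (E c))"
    "lip X\<^sub>2 (\<lambda>y. f y + E c y) = lip X\<^sub>2 f + lip X\<^sub>2 (E c)"
proof -
  obtain c where c: "cmod c = 1" "sigma_norm X\<^sub>2 (\<lambda>y. f y + E c y) = sigma_norm X\<^sub>2 f + 1"
    using constant_direction[OF f] by blast
  have "sup_norm X\<^sub>2 (\<lambda>y. f y + E c y) \<le> sup_norm X\<^sub>2 f + sup_norm X\<^sub>2 (E c)"
    by (rule sup_norm_add_le[OF compact(2) f E_Lip])
  moreover have "lip X\<^sub>2 (\<lambda>y. f y + E c y) \<le> lip X\<^sub>2 f + lip X\<^sub>2 (E c)"
    by (rule lip_add_le[OF f E_Lip])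
  moreover have "sup_norm X\<^sub>2 (E c) + lip X\<^sub>2 (E c) = 1"
    using sigma_norm_E[of c] c(1) by (simp add: sigma_norm_eq)
  ultimately have eq: "sup_norm X\<^sub>2 (\<lambda>y. f y + E c y) = sup_norm X\<^sub>2 f + sup_norm X\<^sub>2 (E c)"
      "lip X\<^sub>2 (\<lambda>y. f y + E c y) = lip X\<^sub>2 f + lip X\<^sub>2 (E c)"
    using c(2) by (simp_all add: sigma_norm_eq)
  have sf: "sup_norm X\<^sub>2 f = cmod (f x)"
    using peak by (intro sup_norm_eqI[OF compact(2) f x]) (metis less_imp_le order_refl)
  obtain z where z: "z \<in> X\<^sub>2" "cmod (f z + E c z) = sup_norm X\<^sub>2 (\<lambda>y. f y + E c y)"
    using sup_norm_attained[OF compact(2) nonempty(2) Lip_add[OF f E_Lip]] by blast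
  have "cmod (f z + E c z) \<le> cmod (f z) + cmod (E c z)" by (rule norm_triangle_ineq)
  moreover have "cmod (E c z) \<le> sup_norm X\<^sub>2 (E c)"
    by (rule sup_norm_upper[OF compact(2) E_Lip z(1)])
  moreover have "cmod (f z) \<le> cmod (f x)" using peak[OF z(1)] by (cases "z = x") auto
  ultimately have zz: "cmod (f z) = cmod (f x)" "cmod (E c z) = sup_norm X\<^sub>2 (E c)"
    using z(2) eq(1) sf by linarith+
  then have "z = x" using peak[OF z(1)] by fastforce
  then have "E c x = f x / of_real (cmod (f x)) * of_real (cmod (E c x))"
    using z(2) zz eq(1) sf fx by (intro cmod_add_eqD) simp_all
  then show ?thesis
    using that[OF c(1) _ eq(2)] zz \<open>z = x\<close> by simp
qed

lemma E_hits_direction: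
  assumes x: "x \<in> X\<^sub>2" and w: "cmod w = 1"
  shows "\<exists>c. cmod c = 1 \<and> E c x = w * of_real (sup_norm X\<^sub>2 (E c))"
proof -
  \<comment> \<open>A peak function at \<open>x\<close> with value \<open>w\<close> there and
    modulus \<open>1 - min 1 (dist x z)\<close> at \<open>z\<close>.\<close>
  define f where "f = (\<lambda>z. w * (cst X\<^sub>2 1 z - of_real (min 1 (Re (dist_fun X\<^sub>2 x z)))))"
  have "(\<lambda>z. of_real (min 1 (Re (dist_fun X\<^sub>2 x z))) :: complex) \<in> Lip X\<^sub>2"
  proof (rule Lip_comp(1)[OF Lip_dist_fun, where C = 1])
    show "cmod (of_real (min 1 (Re z)) - of_real (min 1 (Re w))) \<le> 1 * cmod (z - w)" for z w
      using abs_Re_le_cmod[of "z - w"] by (simp flip: of_real_diff)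
  qed auto
  then have f: "f \<in> Lip X\<^sub>2"
    unfolding f_def by (intro Lip_mult Lip_diff Lip_cst)
  have fz: "cmod (f z) = 1 - min 1 (dist x z)" if "z \<in> X\<^sub>2" for z
  proof -
    have "f z = w * of_real (1 - min 1 (dist x z))"
      using that by (simp add: f_def cst_def dist_fun_def)
    then have "cmod (f z) = cmod w * \<bar>1 - min 1 (dist x z)\<bar>"
      by (simp only: norm_mult norm_of_real)
    then show ?thesis using w by simp
  qed
  have fx: "f x = w" using x by (simp add: f_def cst_def dist_fun_def)
  obtain c where "cmod c = 1" "E c x = f x / of_real (cmod (f x)) * of_real (sup_norm X\<^sub>2 (E c))"
  proof (rule peak_alignment[OF f x])
    show "f x \<noteq> 0" using fx w by auto
    show "cmod (f z) < cmod (f x)" if "z \<in> X\<^sub>2" "z \<noteq> x" for z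
      using fz[OF that(1)] fz[OF x] that(2) by auto
  qed
  then show ?thesis using fx w by auto
qed

lemma sup_norm_E_pos: "cmod c = 1 \<Longrightarrow> sup_norm X\<^sub>2 (E c) > 0"
proof (rule ccontr)
  assume c: "cmod c = 1" and "\<not> sup_norm X\<^sub>2 (E c) > 0"
  then have "E c z = cst X\<^sub>2 0 z" if "z \<in> X\<^sub>2" for z
    using sup_norm_upper[OF compact(2) E_Lip that, of c] sup_norm_nonneg[of X\<^sub>2 "E c"] \<open>\<not> _\<close>
    by (simp add: cst_def)
  then have "E c = cst X\<^sub>2 0" by (intro Lip_ext[OF E_Lip Lip_cst])
  then show False
    using sigma_norm_E[of c] sigma_norm_cst[OF compact(2) nonempty(2), of 0] c by simp
qed

text \<open>By \<open>E_hits_direction\<close> this real-linear map of the plane meets every ray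
  from the origin, so it is onto and, by equality of dimensions, one-to-one.\<close>

lemma inj_E:
  assumes x: "x \<in> X\<^sub>2" shows "inj (\<lambda>c. E c x)"
proof (rule linear_surj_imp_inj[OF linear_E])
  show "surj (\<lambda>c. E c x)"
  proof (rule surjI)
    define g where "g = (\<lambda>w. SOME c. cmod c = 1 \<and> E c x = w * of_real (sup_norm X\<^sub>2 (E c)))"
    show "E (if z = 0 then 0 else (cmod z / sup_norm X\<^sub>2 (E (g (z / of_real (cmod z))))) *\<^sub>R g (z / of_real (cmod z))) x = z" for z
    proof (cases "z = 0")
      case False
      let ?w = "z / of_real (cmod z)"
      have "cmod (g ?w) = 1 \<and> E (g ?w) x = ?w * of_real (sup_norm X\<^sub>2 (E (g ?w)))"
        unfolding g_def by (rule someI_ex[OF E_hits_direction[OF x sgn_unimodular[OF False]]])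
      then show ?thesis
        using False sup_norm_E_pos[of "g ?w"]
        by (simp only: linear_scale[OF linear_E] if_False) (simp add: scaleR_conv_of_real)
    qed (use linear_0[OF linear_E] in simp)
  qed
qed

lemma E_same_direction:
  assumes x: "x \<in> X\<^sub>2" and c: "cmod c = 1" "cmod d = 1"
    and w: "E c x = w * of_real s" "E d x = w * of_real t" "s > 0" "t > 0"
  shows "c = d"
proof -
  have "E ((t / s) *\<^sub>R c) x = E d x"
    using linear_scale[OF linear_E, of "t / s" c x] w by (simp add: scaleR_conv_of_real)
  then have "(t / s) *\<^sub>R c = d" using inj_E[OF x] by (simp add: inj_def)
  moreover from this have "\<bar>t / s\<bar> * cmod c = cmod d" by (metis norm_scaleR)
  then have "t / s = 1" using c w by simp
  ultimately show ?thesis by simp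
qed

text \<open>Some unimodular \<open>d\<close> has a value at \<open>x\<close> in the direction of
  \<open>E c x\<close> with the maximal modulus of \<open>E d\<close>; injectivity forces
  \<open>d = c\<close>.\<close>

lemma cmod_E:
  assumes x: "x \<in> X\<^sub>2" and c: "cmod c = 1"
  shows "cmod (E c x) = sup_norm X\<^sub>2 (E c)"
proof -
  have "E c x \<noteq> 0"
    using inj_E[OF x] linear_0[OF linear_E, of x] c by (metis injD norm_zero zero_neq_one)
  then obtain d where d: "cmod d = 1" "E d x = (E c x / of_real (cmod (E c x))) * of_real (sup_norm X\<^sub>2 (E d))"
    using E_hits_direction[OF x sgn_unimodular] by blast
  then have "c = d"
    using \<open>E c x \<noteq> 0\<close> sup_norm_E_pos
    by (intro E_same_direction[OF x c d(1) _ d(2), of "cmod (E c x)"]) auto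
  then have "cmod (E c x) = cmod (E c x / of_real (cmod (E c x))) * sup_norm X\<^sub>2 (E c)"
    using d(2) by (metis norm_mult norm_of_real abs_of_nonneg sup_norm_nonneg)
  then show ?thesis using sgn_unimodular[OF \<open>E c x \<noteq> 0\<close>] by simp
qed

text \<open>\<open>peak_alignment\<close> supplies some unimodular \<open>d\<close>, and it must be
  \<open>c\<close> since \<open>E c x\<close> already points in the direction of
  \<open>f x\<close>.\<close>

lemma peak_lip_add:
  assumes f: "f \<in> Lip X\<^sub>2" and x: "x \<in> X\<^sub>2" and c: "cmod c = 1"
    and fx: "f x = of_real r * E c x" "r > 0"
    and peak: "\<And>z. z \<in> X\<^sub>2 \<Longrightarrow> z \<noteq> x \<Longrightarrow> cmod (f z) < cmod (f x)"
  shows "lip X\<^sub>2 (\<lambda>y. f y + E c y) = lip X\<^sub>2 f + lip X\<^sub>2 (E c)"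
proof -
  have nz: "E c x \<noteq> 0" using cmod_E[OF x c] sup_norm_E_pos[OF c] by auto
  then have "f x \<noteq> 0" using fx by simp
  then obtain d where d: "cmod d = 1" "E d x = f x / of_real (cmod (f x)) * of_real (sup_norm X\<^sub>2 (E d))"
    "lip X\<^sub>2 (\<lambda>y. f y + E d y) = lip X\<^sub>2 f + lip X\<^sub>2 (E d)"
    using peak_alignment[OF f x _ peak] by blast
  have "c = d"
  proof (rule E_same_direction[OF x c d(1) _ d(2)])
    show "E c x = f x / of_real (cmod (f x)) * of_real (cmod (E c x))"
      using nz fx by (simp add: norm_mult)
  qed (use nz sup_norm_E_pos d in auto)
  then show ?thesis using d by simp
qed

end

section \<open>The images of constants are constant\<close>

lemma lip_attained_finite:
  assumes X: "finite X" and f: "f \<in> Lip X" and pos: "lip X f > 0"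
  obtains a b where "a \<in> X" "b \<in> X" "a \<noteq> b" "cmod (f a - f b) = lip X f * dist a b"
proof -
  define P where "P = {(a, b). a \<in> X \<and> b \<in> X \<and> a \<noteq> b}"
  define R where "R = (\<lambda>(a, b). cmod (f a - f b) / dist a b)"
  have fin: "finite P"
    by (rule finite_subset[of _ "X \<times> X"]) (auto simp: P_def X)
  have ne: "P \<noteq> {}"
  proof
    assume "P = {}"
    then have "lip X f \<le> 0" by (intro lip_le) (auto simp: P_def)
    then show False using pos by simp
  qed
  have "Max (R ` P) \<in> R ` P" using fin ne by (intro Max_in) auto
  then obtain a b where ab: "(a, b) \<in> P" "Max (R ` P) = R (a, b)" by (metis imageE surj_pair)
  have "lip X f \<le> R (a, b)"
  proof (rule lip_le)
    fix u v assume uv: "u \<in> X" "v \<in> X"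
    show "cmod (f u - f v) \<le> R (a, b) * dist u v"
    proof (cases "u = v")
      case False
      then have "R (u, v) \<le> R (a, b)"
        using uv fin unfolding ab(2)[symmetric] by (intro Max_ge) (auto simp: P_def)
      then show ?thesis using False by (simp add: R_def divide_le_eq)
    qed simp
  qed (simp add: R_def)
  then have "lip X f * dist a b \<le> cmod (f a - f b)"
    using ab(1) by (simp add: R_def P_def le_divide_eq)
  moreover have "cmod (f a - f b) \<le> lip X f * dist a b"
    using ab(1) by (intro lip_bound[OF f]) (auto simp: P_def)
  ultimately show ?thesis using that ab(1) by (auto simp: P_def)
qed

context additive_isometry begin

text \<open>
  By \<open>cmod_E\<close> the values of \<open>E c\<close> lie on a circle, so its steep chords near \<open>x\<close> are almost orthogonal
  to \<open>E c x\<close>. A peak function \<open>f\<close> at \<open>x\<close> with values in the direction of \<open>E c x\<close> would however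
  require such chords to be almost parallel to \<open>E c x\<close>.
\<close>

lemma lip_E_limit_point:
  assumes x: "x \<in> X\<^sub>2" "x islimpt X\<^sub>2" and c: "cmod c = 1"
  shows "lip X\<^sub>2 (E c) = 0"
proof (rule ccontr)
  assume "lip X\<^sub>2 (E c) \<noteq> 0"
  define e L m where "e = E c" and "L = lip X\<^sub>2 e" and "m = sup_norm X\<^sub>2 e"
  have L: "L > 0" using \<open>_ \<noteq> 0\<close> lip_nonneg[of X\<^sub>2 e] by (simp add: L_def e_def)
  have m: "m > 0" using sup_norm_E_pos[OF c] by (simp add: m_def e_def)
  have em: "cmod (e z) = m" if "z \<in> X\<^sub>2" for z using cmod_E[OF that c] by (simp add: e_def m_def)
  have eL: "cmod (e a - e b) \<le> L * dist a b" if "a \<in> X\<^sub>2" "b \<in> X\<^sub>2" for a b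
    using lip_bound[OF E_Lip that] by (simp add: e_def L_def)
  define w where "w = e x / of_real m"
  have w: "cmod w = 1" using em[OF x(1)] m by (simp add: w_def norm_divide)
  have ex: "e x = of_real m * w" using m by (simp add: w_def)
  \<comment> \<open>Within distance \<open>3 * r\<close> of \<open>x\<close> the values of
    \<open>e\<close> deviate from \<open>e x\<close> by at most \<open>3 * m / 7\<close>, which is
    less than the \<open>m / 2\<close> that \<open>chord_estimate\<close> would require.\<close>
  define r where "r = m / (7 * L)"
  have r: "r > 0" using L m by (simp add: r_def)
  \<comment> \<open>A peak at \<open>x\<close> in the direction of \<open>e x\<close>, constant at
    distances beyond \<open>r\<close>.\<close>
  define f where "f = (\<lambda>z. w * (cst X\<^sub>2 (of_real (r + 1)) z - of_real (min r (Re (dist_fun X\<^sub>2 x z)))))"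
  have "(\<lambda>z. of_real (min r (Re (dist_fun X\<^sub>2 x z))) :: complex) \<in> Lip X\<^sub>2"
  proof (rule Lip_comp(1)[OF Lip_dist_fun, where C = 1])
    show "cmod (of_real (min r (Re z)) - of_real (min r (Re w))) \<le> 1 * cmod (z - w)" for z w
      using abs_Re_le_cmod[of "z - w"] by (simp flip: of_real_diff)
  qed (use r in auto)
  then have f: "f \<in> Lip X\<^sub>2"
    unfolding f_def by (intro Lip_mult Lip_diff Lip_cst)
  have fz: "f z = w * of_real (r + 1 - min r (dist x z))" if "z \<in> X\<^sub>2" for z
    using that by (simp add: f_def cst_def dist_fun_def)
  have ncf: "cmod (f z) = r + 1 - min r (dist x z)" if "z \<in> X\<^sub>2" for z
    unfolding fz[OF that] norm_mult w norm_of_real by simp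
  have "lip X\<^sub>2 (\<lambda>y. f y + E c y) = lip X\<^sub>2 f + lip X\<^sub>2 (E c)"
  proof (rule peak_lip_add[OF f x(1) c])
    show "f x = of_real ((r + 1) / m) * E c x"
      using ex m fz[OF x(1)] r by (simp add: e_def)
    show "(r + 1) / m > 0" using r m by simp
    show "cmod (f z) < cmod (f x)" if "z \<in> X\<^sub>2" "z \<noteq> x" for z
      using ncf[OF that(1)] ncf[OF x(1)] that(2) r by simp
  qed
  moreover have "lip X\<^sub>2 f \<ge> 1"
  proof -
    obtain z where z: "z \<in> X\<^sub>2" "z \<noteq> x" "dist z x < r"
      using x(2) r unfolding islimpt_approachable by blast
    have "f x - f z = w * of_real (dist x z)"
      using z fz[OF z(1)] fz[OF x(1)] r by (simp add: dist_commute algebra_simps)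
    then have "cmod (f x - f z) = dist x z" using w by (simp add: norm_mult)
    then have "1 * dist x z \<le> lip X\<^sub>2 f * dist x z"
      using lip_bound[OF f x(1) z(1)] by simp
    then show ?thesis using z(2) by (simp add: mult_le_cancel_right)
  qed
  \<comment> \<open>The threshold of \<open>aligned_estimate\<close>. It lies below
    \<open>1 + L\<close>, so some difference quotient of \<open>f + e\<close> exceeds it.\<close>
  moreover define B where "B = 1 + L - L / (2 * (1 + L))"
  have "L / (2 * (1 + L)) \<le> 1" "L / (2 * (1 + L)) > 0" using L by (simp_all add: divide_le_eq)
  then have B: "0 \<le> B" "B < 1 + L" unfolding B_def using L by linarith+
  ultimately have "B < lip X\<^sub>2 (\<lambda>y. f y + e y)"
    by (simp add: e_def L_def)
  then obtain a b where ab: "a \<in> X\<^sub>2" "b \<in> X\<^sub>2" "a \<noteq> b" "cmod (f a + e a - (f b + e b)) > B * dist a b"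
    using lip_approx[OF Lip_add[OF f E_Lip[of c]], of B] B(1) by (auto simp: e_def)
  \<comment> \<open>By symmetry \<open>a\<close> may be the point with the smaller truncated
    distance to \<open>x\<close>.\<close>
  have key: False if ab: "a \<in> X\<^sub>2" "b \<in> X\<^sub>2" "a \<noteq> b" "cmod (f a + e a - (f b + e b)) > B * dist a b"
    and le: "min r (dist x a) \<le> min r (dist x b)" for a b
  proof -
    define D where "D = dist a b"
    have D: "D > 0" using ab(3) by (simp add: D_def)
    define p where "p = (min r (dist x b) - min r (dist x a)) / D"
    define q where "q = (e a - e b) / of_real D"
    have "\<bar>dist x b - dist x a\<bar> \<le> D"
      using abs_dist_diff_le[of b x a] by (simp add: D_def dist_commute)
    then have "min r (dist x b) - min r (dist x a) \<le> D" by linarith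
    then have p: "0 \<le> p" "p \<le> 1" using le D by (simp_all add: p_def divide_le_eq)
    have q: "cmod q \<le> L" using eL[OF ab(1,2)] D by (simp add: q_def norm_divide D_def divide_le_eq)
    have "w * of_real p + q = (f a + e a - (f b + e b)) / of_real D"
      using D by (simp add: fz[OF ab(1)] fz[OF ab(2)] p_def q_def field_simps)
    then have "cmod (w * of_real p + q) = cmod (f a + e a - (f b + e b)) / D"
      using D by (simp add: norm_divide)
    also have "\<dots> \<ge> B" using ab(4) D by (simp add: le_divide_eq D_def)
    finally have pq: "p * Re (cnj w * q) \<ge> L / 2"
      using p q w L by (intro aligned_estimate) (auto simp: B_def)
    then have "Re (cnj w * q) > 0" using p(1) L by (smt (verit) half_gt_zero mult_nonneg_nonpos)
    then have Rq: "Re (cnj w * q) \<ge> L / 2"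
      using pq mult_right_mono[OF p(2) less_imp_le[OF \<open>Re (cnj w * q) > 0\<close>]] by linarith
    have "Re (cnj w * q) \<le> L"
      using complex_Re_le_cmod[of "cnj w * q"] q w by (simp add: norm_mult)
    then have "p * Re (cnj w * q) \<le> p * L" using p(1) by (rule mult_left_mono)
    then have "L * (1 / 2) \<le> L * p" using pq by (simp only: mult.commute)
    \<comment> \<open>The truncated distances to \<open>x\<close> differ by at least half of
      \<open>D\<close> and by at most \<open>r\<close>. So \<open>a\<close> is within
      \<open>r\<close> of \<open>x\<close>, and \<open>b\<close> within
      \<open>3 * r\<close>.\<close>
    then have p2: "p \<ge> 1 / 2" using L by simp
    then have "D / 2 \<le> min r (dist x b) - min r (dist x a)"
      using D by (simp add: p_def le_divide_eq)
    then have ar: "dist x a \<le> r" "D \<le> 2 * r"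
      using D zero_le_dist[of x a] r by linarith+
    then have br: "dist x b \<le> 3 * r" using dist_triangle[of x b a] by (simp add: D_def)
    have "m * (L / 2 * D) \<le> L * (3 * r) * (L * D)"
    proof (rule chord_estimate[OF em[OF ab(1)] em[OF ab(2)] w])
      show "cmod (e a - of_real m * w) \<le> L * (3 * r)"
        unfolding ex[symmetric] using eL[OF ab(1) x(1)] ar(1) r L
        by (intro order_trans[OF _ mult_left_mono[of "dist a x" "3 * r" L]]) (auto simp: dist_commute)
      show "cmod (e b - of_real m * w) \<le> L * (3 * r)"
        unfolding ex[symmetric] using eL[OF ab(2) x(1)] br L
        by (intro order_trans[OF _ mult_left_mono[of "dist b x" "3 * r" L]]) (auto simp: dist_commute)
      have "e a - e b = of_real D * q" using D by (simp add: q_def)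
      then have "Re (cnj w * (e a - e b)) = D * Re (cnj w * q)" by (simp add: algebra_simps)
      then show "L / 2 * D \<le> Re (cnj w * (e a - e b))"
        using mult_left_mono[OF Rq, of D] D by (simp add: mult.commute)
      show "cmod (e a - e b) \<le> L * D" using eL[OF ab(1,2)] by (simp add: D_def)
    qed
    then have "(m * L * D) * 7 \<le> (m * L * D) * 6"
      using L by (simp add: r_def field_simps power2_eq_square)
    moreover have "m * L * D > 0" using m L D by simp
    ultimately show False by linarith
  qed
  show False
  proof (cases "min r (dist x a) \<le> min r (dist x b)")
    case False
    have "cmod (f b + e b - (f a + e a)) = cmod (f a + e a - (f b + e b))"
      by (rule norm_minus_commute)
    then have "B * dist b a < cmod (f b + e b - (f a + e a))" using ab(4) by (simp only: dist_commute)
    then show ?thesis using False by (intro key[of b a] ab(1,2) ab(3)[symmetric]) auto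
  qed (use key[of a b] ab in simp)
qed

text \<open>
  In a finite space chords have positive length. Varying the phase \<open>\<zeta>\<close> of the peak at \<open>x\<close> relative
  to \<open>E c x\<close> prescribes the angle between the radius and a chord of the fixed length \<open>L * \<rho>\<close>.
\<close>

lemma lip_E_finite:
  assumes fin: "finite X\<^sub>2" and c: "cmod c = 1"
  shows "lip X\<^sub>2 (E c) = 0"
proof (rule ccontr)
  assume "lip X\<^sub>2 (E c) \<noteq> 0"
  define e L m where "e = E c" and "L = lip X\<^sub>2 e" and "m = sup_norm X\<^sub>2 e"
  have L: "L > 0" using \<open>_ \<noteq> 0\<close> lip_nonneg[of X\<^sub>2 e] by (simp add: L_def e_def)
  have m: "m > 0" using sup_norm_E_pos[OF c] by (simp add: m_def e_def)
  have em: "cmod (e z) = m" if "z \<in> X\<^sub>2" for z using cmod_E[OF that c] by (simp add: e_def m_def)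
  have eL: "cmod (e a - e b) \<le> L * dist a b" if "a \<in> X\<^sub>2" "b \<in> X\<^sub>2" for a b
    using lip_bound[OF E_Lip that] by (simp add: e_def L_def)
  obtain x x' where x: "x \<in> X\<^sub>2" and x': "x' \<in> X\<^sub>2" "x' \<noteq> x"
    using lip_attained_finite[OF fin E_Lip, of c] L unfolding L_def e_def by metis
  define w where "w = e x / of_real m"
  have w: "cmod w = 1" using em[OF x] m by (simp add: w_def norm_divide)
  have ex: "e x = of_real m * w" using m by (simp add: w_def)
  define \<rho> where "\<rho> = Min (dist x ` (X\<^sub>2 - {x}))"
  have dne: "dist x ` (X\<^sub>2 - {x}) \<noteq> {}" using x' by auto
  have \<rho>le: "\<rho> \<le> dist x z" if "z \<in> X\<^sub>2" "z \<noteq> x" for z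
    unfolding \<rho>_def using fin that by (intro Min_le) auto
  have "\<rho> \<in> dist x ` (X\<^sub>2 - {x})" unfolding \<rho>_def using fin dne by (intro Min_in) auto
  then obtain y where y: "y \<in> X\<^sub>2" "y \<noteq> x" "dist x y = \<rho>" by blast
  have \<rho>: "\<rho> > 0" using y by auto
  have key: "L * \<rho> = 2 * m * Re \<zeta>" if \<zeta>: "cmod \<zeta> = 1" "Re \<zeta> > 0" for \<zeta>
  proof -
    \<comment> \<open>With this \<open>M\<close>,
      \<open>(cmod (of_real M - \<zeta>))\<^sup>2 = M\<^sup>2 - 1\<close>, so \<open>f\<close> below
      peaks at \<open>x\<close>.\<close>
    define M where "M = 1 / Re \<zeta>"
    have M: "M > 0" using \<zeta> by (simp add: M_def)
    define f where "f = (\<lambda>z. if z \<in> X\<^sub>2 then w * (of_real M - (if z = x then 0 else \<zeta>)) else 0)"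
    have fx: "f x = w * of_real M" using x by (simp add: f_def)
    have fz: "f z = w * (of_real M - \<zeta>)" if "z \<in> X\<^sub>2" "z \<noteq> x" for z
      using that by (simp add: f_def)
    have wz: "cmod (w * \<zeta>) = 1" using w \<zeta> by (simp add: norm_mult)
    have fd: "cmod (f a - f b) \<le> 1 / \<rho> * dist a b" if "a \<in> X\<^sub>2" "b \<in> X\<^sub>2" for a b
    proof -
      have "f a - f b = (if a = x then 0 else - (w * \<zeta>)) - (if b = x then 0 else - (w * \<zeta>))"
        using that by (simp add: f_def algebra_simps)
      then show ?thesis
        using \<rho>le[of a] \<rho>le[of b] that \<rho> wz by (auto simp: le_divide_eq dist_commute)
    qed
    have f: "f \<in> Lip X\<^sub>2" by (rule LipI[OF fd]) (simp_all add: f_def)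
    have lf: "lip X\<^sub>2 f = 1 / \<rho>"
    proof (rule antisym)
      show "lip X\<^sub>2 f \<le> 1 / \<rho>" by (rule lip_le[OF fd]) (use \<rho> in auto)
      have "f x - f y = w * \<zeta>" using fz[OF y(1,2)] fx by (simp add: algebra_simps)
      then have "1 \<le> lip X\<^sub>2 f * \<rho>"
        using lip_bound[OF f x y(1)] wz y(3) by simp
      then show "1 / \<rho> \<le> lip X\<^sub>2 f" using \<rho> by (simp add: divide_le_eq)
    qed
    have lfe: "lip X\<^sub>2 (\<lambda>z. f z + e z) = 1 / \<rho> + L"
      unfolding e_def L_def lf[symmetric]
    proof (rule peak_lip_add[OF f x c])
      show "f x = of_real (M / m) * E c x" using ex m fx by (simp add: e_def)
      show "M / m > 0" using M m by simp
      have "(cmod (of_real M - \<zeta>))\<^sup>2 = M\<^sup>2 - 2 * M * Re \<zeta> + (cmod \<zeta>)\<^sup>2"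
        by (simp only: cmod_power2) (simp add: power2_eq_square algebra_simps)
      then have "(cmod (of_real M - \<zeta>))\<^sup>2 < M\<^sup>2" using \<zeta> by (simp add: M_def)
      then have "cmod (of_real M - \<zeta>) < M" using M by (simp add: power2_less_imp_less)
      then show "cmod (f z) < cmod (f x)" if "z \<in> X\<^sub>2" "z \<noteq> x" for z
        using fz[OF that] fx w M by (simp add: norm_mult)
    qed
    have fe: "(\<lambda>z. f z + e z) \<in> Lip X\<^sub>2" unfolding e_def by (rule Lip_add[OF f E_Lip])
    have "1 / \<rho> + L > 0" using \<rho> L by (simp add: add_pos_pos)
    then obtain a b where ab: "a \<in> X\<^sub>2" "b \<in> X\<^sub>2" "a \<noteq> b"
        "cmod (f a + e a - (f b + e b)) = (1 / \<rho> + L) * dist a b"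
      using lip_attained_finite[OF fin fe] unfolding lfe by blast
    have "\<exists>b\<in>X\<^sub>2. b \<noteq> x \<and> cmod (f x + e x - (f b + e b)) = (1 / \<rho> + L) * dist x b"
    proof -
      \<comment> \<open>Away from \<open>x\<close> the function \<open>f\<close> is constant and
        \<open>f + e\<close> has difference quotients at most \<open>L\<close>, so a maximal pair
        involves \<open>x\<close>.\<close>
      have "a = x \<or> b = x"
      proof (rule ccontr)
        assume "\<not> ?thesis"
        then have "f a = f b" using fz ab by simp
        then have "(1 / \<rho> + L) * dist a b \<le> L * dist a b"
          using ab(4) eL[OF ab(1,2)] by simp
        then show False using ab(3) \<rho> by (simp add: mult_le_cancel_right)
      qed
      then show ?thesis
        using ab by (metis dist_commute norm_minus_commute)
    qed
    then obtain b where b: "b \<in> X\<^sub>2" "b \<noteq> x" "cmod (f x + e x - (f b + e b)) = (1 / \<rho> + L) * dist x b"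
      by blast
    have eq: "f x + e x - (f b + e b) = w * \<zeta> + (e x - e b)"
      using fz[OF b(1,2)] fx by (simp add: algebra_simps)
    have tri: "cmod (w * \<zeta> + (e x - e b)) \<le> cmod (w * \<zeta>) + cmod (e x - e b)"
      by (rule norm_triangle_ineq)
    have ge: "1 / \<rho> * dist x b \<ge> 1" using \<rho>le[OF b(1,2)] \<rho> by (simp add: le_divide_eq)
    have tot: "cmod (w * \<zeta> + (e x - e b)) = 1 / \<rho> * dist x b + L * dist x b"
      using b(3) unfolding eq by (simp add: ring_distribs)
    \<comment> \<open>Equality in the triangle inequality: \<open>b\<close> is a nearest point to
      \<open>x\<close>, and the chord from \<open>e b\<close> to \<open>e x\<close> has the full
      length \<open>L * \<rho>\<close>.\<close>
    have one: "1 / \<rho> * dist x b = 1" and Ld: "cmod (e x - e b) = L * dist x b"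
      using tri ge tot eL[OF x b(1)] wz by linarith+
    have db: "dist x b = \<rho>" using one \<rho> by (simp add: divide_eq_eq)
    have "e x - e b = (w * \<zeta>) / of_real (cmod (w * \<zeta>)) * of_real (cmod (e x - e b))"
      using tot one Ld wz by (intro cmod_add_eqD) auto
    then have "e b = w * (of_real m - \<zeta> * of_real (L * \<rho>))"
      unfolding wz Ld db using ex by (simp add: algebra_simps)
    \<comment> \<open>Both ends of the chord lie on the circle of radius \<open>m\<close>, which
      determines its length from its direction as \<open>2 * m * Re \<zeta>\<close>.\<close>
    then have "cmod (of_real m - \<zeta> * of_real (L * \<rho>)) = m"
      using em[OF b(1)] w by (simp add: norm_mult)
    then have "m\<^sup>2 = (cmod (of_real m - \<zeta> * of_real (L * \<rho>)))\<^sup>2" by simp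
    also have "\<dots> = m\<^sup>2 - 2 * m * Re \<zeta> * (L * \<rho>) + (cmod \<zeta>)\<^sup>2 * (L * \<rho>)\<^sup>2"
      by (simp only: cmod_power2) (simp add: power2_eq_square algebra_simps)
    finally have "(L * \<rho>)\<^sup>2 - 2 * m * Re \<zeta> * (L * \<rho>) = 0"
      unfolding \<zeta>(1) by simp
    then have "(L * \<rho>) * (L * \<rho> - 2 * m * Re \<zeta>) = 0"
      by (simp only: power2_eq_square right_diff_distrib mult.commute)
    then show ?thesis using L \<rho> by auto
  qed
  \<comment> \<open>Two phases with different real parts demand different values of the same number
    \<open>L * \<rho>\<close>.\<close>
  have "cmod (Complex (3/5) (4/5)) = 1" by (simp add: cmod_def power2_eq_square)
  then have "L * \<rho> = 2 * m * (3 / 5)" using key[of "Complex (3/5) (4/5)"] by simp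
  moreover have "L * \<rho> = 2 * m" using key[of 1] by simp
  ultimately show False using m by simp
qed

text \<open>The choice of the point is immaterial by \<open>V_cst\<close>.\<close>

definition A :: "complex \<Rightarrow> complex" where
  "A c = E c (SOME y. y \<in> X\<^sub>2)"

lemma linear_A: "linear A"
  unfolding A_def by (rule linear_E)

text \<open>An infinite compact space has a limit point, so \<open>lip_E_limit_point\<close> and
  \<open>lip_E_finite\<close> cover all cases. Real linearity extends the result from unimodular
  \<open>c\<close> to all \<open>c\<close>.\<close>

lemma V_cst: "V (cst X\<^sub>1 c) = cst X\<^sub>2 (A c)"
proof -
  define y where "y = (SOME y. y \<in> X\<^sub>2)"
  have y: "y \<in> X\<^sub>2" unfolding y_def using nonempty(2) by (simp add: some_in_eq)
  have unit: "lip X\<^sub>2 (E c) = 0" if c: "cmod c = 1" for c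
  proof (cases "finite X\<^sub>2")
    case False
    then obtain x where "x \<in> X\<^sub>2" "x islimpt X\<^sub>2"
      using Heine_Borel_imp_Bolzano_Weierstrass[OF compact(2) False] by auto
    then show ?thesis using lip_E_limit_point c by blast
  qed (rule lip_E_finite[OF _ c])
  have "E c z = A c" if z: "z \<in> X\<^sub>2" for z
  proof (cases "c = 0")
    case True
    then show ?thesis by (simp add: A_def linear_0[OF linear_E])
  next
    case False
    let ?d = "c / of_real (cmod c)"
    have "cmod (E ?d z - E ?d y) \<le> 0"
      using lip_bound[OF E_Lip z y, of ?d] unit[OF sgn_unimodular[OF False]] by simp
    then have "cmod c *\<^sub>R E ?d z = cmod c *\<^sub>R E ?d y" by simp
    then have "E (cmod c *\<^sub>R ?d) z = E (cmod c *\<^sub>R ?d) y"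
      by (simp only: linear_scale[OF linear_E])
    then show ?thesis using False by (simp add: A_def y_def scaleR_conv_of_real)
  qed
  then have "E c = cst X\<^sub>2 (A c)"
    by (intro Lip_ext[OF E_Lip Lip_cst]) (simp add: cst_def)
  then show ?thesis by (simp add: E_def)
qed

lemma cmod_A: "cmod (A c) = cmod c"
  using isometric[OF Lip_cst, of c]
  by (simp add: V_cst sigma_norm_cst compact nonempty)

end

section \<open>Unital isometries\<close>

text \<open>For real \<open>f\<close> the sets where \<open>f x = P f\<close> are closed in a
  compact space, so it suffices that finitely many of them meet. \<open>P\<close> vanishes at the
  sum of the functions \<open>\<bar>f - P f\<bar>\<close>; by \<open>hull\<close> the minimum of
  this sum is 0, and it is attained at a common point. Complex functions are split into real and
  imaginary part.\<close>

lemma point_evaluation: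
  fixes X :: "'a::metric_space set" and P :: "('a \<Rightarrow> complex) \<Rightarrow> complex"
  assumes X: "compact X" "X \<noteq> {}"
    and add: "\<And>f g. f \<in> Lip X \<Longrightarrow> g \<in> Lip X \<Longrightarrow> P (\<lambda>x. f x + g x) = P f + P g"
    and hull: "\<And>f a b s. f \<in> Lip X \<Longrightarrow> (\<And>x. x \<in> X \<Longrightarrow> a * Re (f x) + b * Im (f x) \<le> s) \<Longrightarrow>
      a * Re (P f) + b * Im (P f) \<le> s"
    and abs: "\<And>f. f \<in> Lip X \<Longrightarrow> (\<And>x. x \<in> X \<Longrightarrow> Im (f x) = 0) \<Longrightarrow>
      P (\<lambda>x. of_real (cmod (f x))) = of_real (cmod (P f))"
  shows "\<exists>x\<in>X. \<forall>f\<in>Lip X. P f = f x"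
proof -
  have const: "P (cst X c) = c" for c
  proof (rule complex_eqI)
    show "Re (P (cst X c)) = Re c"
      using hull[OF Lip_cst[of X c], of 1 0 "Re c"] hull[OF Lip_cst[of X c], of "-1" 0 "- Re c"]
      by (simp add: cst_def)
    show "Im (P (cst X c)) = Im c"
      using hull[OF Lip_cst[of X c], of 0 1 "Im c"] hull[OF Lip_cst[of X c], of 0 "-1" "- Im c"]
      by (simp add: cst_def)
  qed
  have zero: "P (\<lambda>x. 0) = 0" using add[OF Lip_zero Lip_zero] by simp
  have minus_const: "P (\<lambda>x. f x - cst X c x) = P f - c" if "f \<in> Lip X" for f c
  proof -
    have "P (\<lambda>x. f x - cst X c x + cst X c x) = P (\<lambda>x. f x - cst X c x) + P (cst X c)"
      by (rule add[OF Lip_diff[OF that Lip_cst] Lip_cst])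
    then show ?thesis by (simp add: const)
  qed
  have real: "Im (P f) = 0" if "f \<in> Lip X" "\<And>x. x \<in> X \<Longrightarrow> Im (f x) = 0" for f
    using hull[OF that(1), of 0 1 0] hull[OF that(1), of 0 "-1" 0] that(2) by simp
  have imag: "P (\<lambda>x. \<i> * f x) = \<i> * P f" if f: "f \<in> Lip X" "\<And>x. x \<in> X \<Longrightarrow> Im (f x) = 0" for f
  proof -
    have fi: "(\<lambda>x. \<i> * f x) \<in> Lip X" by (rule Lip_mult[OF f(1)])
    have "Re (P (\<lambda>x. \<i> * f x)) = 0"
      using hull[OF fi, of 1 0 0] hull[OF fi, of "-1" 0 0] f(2) by simp
    \<comment> \<open>The values of \<open>f + \<i> f\<close> lie on the diagonal, and
      \<open>hull\<close> in the two directions across it keeps the image there.\<close>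
    moreover have "Re (P (\<lambda>x. f x + \<i> * f x)) = Im (P (\<lambda>x. f x + \<i> * f x))"
      using hull[OF Lip_add[OF f(1) fi], of 1 "-1" 0] hull[OF Lip_add[OF f(1) fi], of "-1" 1 0] f(2)
      by simp
    ultimately show ?thesis
      using add[OF f(1) fi] real[OF f] by (simp add: complex_eq_iff)
  qed
  define R where "R = {f \<in> Lip X. \<forall>x\<in>X. Im (f x) = 0}"
  define Z where "Z = (\<lambda>f. {x \<in> X. f x = P f})"
  have "X \<inter> \<Inter> (Z ` R) \<noteq> {}"
  proof (rule compact_imp_fip[OF X(1)])
    show "closed T" if "T \<in> Z ` R" for T
    proof -
      obtain f where f: "f \<in> R" "T = Z f" using \<open>T \<in> Z ` R\<close> by blast
      then have "continuous_on X f" using Lip_continuous by (auto simp: R_def)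
      then show ?thesis
        unfolding f(2) Z_def
        by (rule continuous_closed_preimage_constant[OF _ compact_imp_closed[OF X(1)]])
    qed
    fix F assume F: "finite F" "F \<subseteq> Z ` R"
    obtain I where I: "finite I" "I \<subseteq> R" "F = Z ` I"
      using finite_subset_image[OF F] by blast
    define G where "G = (\<lambda>I x. \<Sum>f\<in>I. complex_of_real (cmod (f x - cst X (P f) x)))"
    have "G I \<in> Lip X \<and> P (G I) = 0" using I(1,2)
    proof (induction I)
      case empty
      then show ?case using zero Lip_zero by (simp add: G_def)
    next
      case (insert f I)
      have f: "f \<in> Lip X" "\<And>x. x \<in> X \<Longrightarrow> Im (f x) = 0" using insert.prems by (auto simp: R_def)
      let ?h = "\<lambda>x. complex_of_real (cmod (f x - cst X (P f) x))"
      have d: "(\<lambda>x. f x - cst X (P f) x) \<in> Lip X" by (rule Lip_diff[OF f(1) Lip_cst])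
      have "P ?h = of_real (cmod (P (\<lambda>x. f x - cst X (P f) x)))"
        using f(2) real[OF f] by (intro abs[OF d]) (simp add: cst_def)
      then have "P ?h = 0" using minus_const[OF f(1), of "P f"] by simp
      moreover have "G (insert f I) = (\<lambda>x. ?h x + G I x)"
        using insert.hyps by (simp add: G_def)
      ultimately show ?case
        using insert Lip_cmod[OF d] add[OF Lip_cmod[OF d], of "G I"] Lip_add[OF Lip_cmod[OF d], of "G I"]
        by simp
    qed
    then have GL: "G I \<in> Lip X" and PG: "P (G I) = 0" by auto
    have ReG: "Re (G I x) = (\<Sum>f\<in>I. cmod (f x - cst X (P f) x))" for x
      by (simp add: G_def)
    obtain x where x: "x \<in> X" "\<And>z. z \<in> X \<Longrightarrow> Re (G I x) \<le> Re (G I z)"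
      using continuous_attains_inf[OF X, of "\<lambda>x. Re (G I x)"]
        continuous_on_Re[OF Lip_continuous[OF GL]] by blast
    have "Re (G I x) \<le> 0"
      using hull[OF GL, of "-1" 0 "- Re (G I x)"] x(2) PG by simp
    then have "(\<Sum>f\<in>I. cmod (f x - cst X (P f) x)) = 0"
      unfolding ReG by (intro antisym sum_nonneg) auto
    then have "\<forall>f\<in>I. cmod (f x - cst X (P f) x) = 0"
      by (subst (asm) sum_nonneg_eq_0_iff[OF I(1)]) auto
    then have "x \<in> Z f" if "f \<in> I" for f
      using that x(1) by (simp add: Z_def cst_def)
    then show "X \<inter> \<Inter> F \<noteq> {}" using x(1) I(3) by blast
  qed
  then obtain x where x: "x \<in> X" "\<And>f. f \<in> R \<Longrightarrow> P f = f x" by (force simp: Z_def)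
  have "P f = f x" if f: "f \<in> Lip X" for f
  proof -
    let ?u = "\<lambda>x. complex_of_real (Re (f x))" and ?v = "\<lambda>x. complex_of_real (Im (f x))"
    have "f = (\<lambda>x. ?u x + \<i> * ?v x)" by (simp add: complex_eq_iff fun_eq_iff)
    then have "P f = P ?u + P (\<lambda>x. \<i> * ?v x)"
      using add[OF Lip_Re[OF f] Lip_mult[OF Lip_Im[OF f]], of \<i>] by simp
    moreover have "P (\<lambda>x. \<i> * ?v x) = \<i> * P ?v" by (rule imag[OF Lip_Im[OF f]]) simp
    moreover have "P ?u = ?u x" "P ?v = ?v x"
      using Lip_Re[OF f] Lip_Im[OF f] by (auto intro!: x(2) simp: R_def)
    ultimately show ?thesis by (simp add: complex_eq_iff)
  qed
  then show ?thesis using x(1) by blast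
qed

text \<open>In the application \<open>P\<close> and \<open>Q\<close> are the components along and
  across a direction of a point in the disc of radius \<open>R\<close>, and \<open>s\<close> is its
  distance to the boundary point in that direction. For \<open>s \<le> 1\<close> the decay of the
  spike of height \<open>\<alpha>\<close> gives the corner, for larger \<open>s\<close> the
  curvature of the circle.\<close>

lemma corner_inequality:
  fixes P Q R s \<alpha> :: real
  assumes "R > 0" "\<alpha> > 0" "s \<ge> 0" "\<bar>Q\<bar> \<le> s" "2 * R * P \<le> 2 * R\<^sup>2 - s\<^sup>2"
  shows "P + \<alpha> * max 0 (1 - s) \<le> R + \<alpha> - min \<alpha> (1 / (2 * R)) * \<bar>Q\<bar>"
proof -
  let ?\<gamma> = "min \<alpha> (1 / (2 * R))"
  have "2 * R * (R - s\<^sup>2 / (2 * R)) = 2 * R\<^sup>2 - s\<^sup>2"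
    using assms(1) by (simp add: right_diff_distrib power2_eq_square)
  then have "2 * R * P \<le> 2 * R * (R - s\<^sup>2 / (2 * R))" using assms(5) by simp
  then have P: "P \<le> R - s\<^sup>2 / (2 * R)" using assms(1) by simp
  have \<gamma>: "?\<gamma> \<ge> 0" using assms by simp
  have Q: "?\<gamma> * \<bar>Q\<bar> \<le> ?\<gamma> * s" by (rule mult_left_mono[OF assms(4) \<gamma>])
  have sq: "s\<^sup>2 / (2 * R) \<ge> 0" using assms(1) by simp
  show ?thesis
  proof (cases "s \<le> 1")
    case True
    have "?\<gamma> * s \<le> \<alpha> * s" using assms(3) by (intro mult_right_mono) auto
    then show ?thesis using True P Q sq by (simp add: algebra_simps)
  next
    case False
    have "?\<gamma> * s \<le> 1 / (2 * R) * s" using assms(3) by (intro mult_right_mono) auto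
    also have "\<dots> \<le> s\<^sup>2 / (2 * R)" using False assms(1) by (simp add: power2_eq_square divide_right_mono)
    finally show ?thesis using False P Q assms(2) by simp
  qed
qed

locale unital_isometry = additive_isometry +
  assumes unital: "\<And>c. V (cst X\<^sub>1 c) = cst X\<^sub>2 c"
begin

lemma inverse_unital_isometry: "unital_isometry X\<^sub>2 X\<^sub>1 Vinv"
proof -
  interpret inv: additive_isometry X\<^sub>2 X\<^sub>1 Vinv by (rule inverse_isometry)
  show ?thesis by standard (metis Lip_cst Vinv_V unital)
qed

text \<open>Adding a large constant turns the norm into the support function of the range plus \<open>lip\<close>.\<close>

lemma support_le:
  assumes f: "f \<in> Lip X\<^sub>1" and ab: "a\<^sup>2 + b\<^sup>2 = 1"
    and s: "\<And>x. x \<in> X\<^sub>1 \<Longrightarrow> a * Re (f x) + b * Im (f x) \<le> s" and y: "y \<in> X\<^sub>2"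
  shows "a * Re (V f y) + b * Im (V f y) \<le> s + (lip X\<^sub>1 f - lip X\<^sub>2 (V f))"
proof (rule ccontr)
  assume n: "\<not> ?thesis"
  define D where "D = lip X\<^sub>1 f - lip X\<^sub>2 (V f)"
  define \<delta> where "\<delta> = a * Re (V f y) + b * Im (V f y) - (s + D)"
  have \<delta>: "\<delta> > 0" using n by (simp add: \<delta>_def D_def)
  define B where "B = sup_norm X\<^sub>1 f"
  \<comment> \<open>Squaring costs an error of at most \<open>B\<^sup>2\<close> against the gain
    \<open>2 * t * \<delta>\<close>; this \<open>t\<close> makes the gain prevail and
    \<open>t + s + \<delta>\<close> nonnegative.\<close>
  define t where "t = B\<^sup>2 / \<delta> + \<bar>s + \<delta>\<bar> + 1"
  have t: "t \<ge> 0" "t + s + \<delta> \<ge> 0"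
  proof -
    have "B\<^sup>2 / \<delta> \<ge> 0" using \<delta> by simp
    then show "t \<ge> 0" "t + s + \<delta> \<ge> 0" unfolding t_def by linarith+
  qed
  have t2: "t * \<delta> \<ge> B\<^sup>2 + \<delta>"
  proof -
    have "t * \<delta> = B\<^sup>2 + (\<bar>s + \<delta>\<bar> + 1) * \<delta>" using \<delta> by (simp add: t_def field_simps)
    also have "\<dots> \<ge> B\<^sup>2 + 1 * \<delta>" using \<delta> by (intro add_left_mono mult_right_mono) auto
    finally show ?thesis by simp
  qed
  define w where "w = Complex a b"
  have "cmod w = 1" using ab by (simp add: w_def cmod_def)
  let ?c = "of_real t * w"
  have "t + s + D + \<delta> = Re (cnj w * (V f y + ?c))"
  proof -
    have "Re (cnj w * (V f y + ?c)) = a * Re (V f y) + b * Im (V f y) + t * (a\<^sup>2 + b\<^sup>2)"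
      by (simp add: w_def algebra_simps power2_eq_square)
    then show ?thesis using ab by (simp add: \<delta>_def)
  qed
  also have "\<dots> \<le> cmod (cnj w * (V f y + ?c))" by (rule complex_Re_le_cmod)
  also have "\<dots> = cmod (V f y + cst X\<^sub>2 ?c y)" using \<open>cmod w = 1\<close> y by (simp add: norm_mult cst_def)
  also have "\<dots> \<le> sup_norm X\<^sub>2 (\<lambda>y. V f y + cst X\<^sub>2 ?c y)"
    by (rule sup_norm_upper[OF compact(2) Lip_add[OF V_Lip[OF f] Lip_cst] y])
  also have "\<dots> = sup_norm X\<^sub>1 (\<lambda>x. f x + cst X\<^sub>1 ?c x) + D"
    using isometric[OF Lip_add[OF f Lip_cst], of ?c] add[OF f Lip_cst, of ?c]
      lip_add_cst[OF f, of ?c] lip_add_cst[OF V_Lip[OF f], of ?c]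
    by (simp add: unital sigma_norm_eq D_def)
  finally have "t + s + \<delta> \<le> sup_norm X\<^sub>1 (\<lambda>x. f x + cst X\<^sub>1 ?c x)" by simp
  moreover obtain x where x: "x \<in> X\<^sub>1"
      "cmod (f x + cst X\<^sub>1 ?c x) = sup_norm X\<^sub>1 (\<lambda>x. f x + cst X\<^sub>1 ?c x)"
    using sup_norm_attained[OF compact(1) nonempty(1) Lip_add[OF f Lip_cst]] by blast
  ultimately have "t + s + \<delta> \<le> cmod (f x + ?c)" by (simp add: cst_def)
  then have "(t + s + \<delta>)\<^sup>2 \<le> (cmod (f x + ?c))\<^sup>2" using t(2) by (rule power_mono)
  also have "\<dots> = (cmod (f x))\<^sup>2 + 2 * t * (a * Re (f x) + b * Im (f x)) + t\<^sup>2 * (a\<^sup>2 + b\<^sup>2)"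
    by (simp only: cmod_power2) (simp add: w_def power2_eq_square algebra_simps)
  also have "\<dots> \<le> B\<^sup>2 + 2 * t * s + t\<^sup>2 * (a\<^sup>2 + b\<^sup>2)"
    using sup_norm_upper[OF compact(1) f x(1)] s[OF x(1)] t(1)
    by (intro add_right_mono add_mono power_mono mult_left_mono[of _ s]) (auto simp: B_def)
  finally have "(s + \<delta>)\<^sup>2 + 2 * (t * \<delta>) \<le> B\<^sup>2"
    unfolding ab by (simp add: power2_eq_square algebra_simps)
  moreover have "(s + \<delta>)\<^sup>2 \<ge> 0" "B\<^sup>2 \<ge> 0" by simp_all
  ultimately show False using t2 \<delta> by linarith
qed

text \<open>
  By \<open>support_le\<close> for \<open>V\<close> and its inverse, a negative value of \<open>lip X\<^sub>1 f - lip X\<^sub>2 (V f)\<close>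
  would make the convex hull of the range of \<open>f\<close> a sum of a convex set and a disc. Such a sum
  has no corners.
\<close>

lemma corner_lip_le:
  assumes f: "f \<in> Lip X\<^sub>1" and ab: "a\<^sup>2 + b\<^sup>2 = 1" and \<gamma>: "\<gamma> > 0"
    and x: "x \<in> X\<^sub>1" "a * Re (f x) + b * Im (f x) = v"
    and le: "\<And>x. x \<in> X\<^sub>1 \<Longrightarrow> a * Re (f x) + b * Im (f x) \<le> v - \<gamma> * \<bar>a * Im (f x) - b * Re (f x)\<bar>"
  shows "lip X\<^sub>2 (V f) \<le> lip X\<^sub>1 f"
proof (rule ccontr)
  assume "\<not> ?thesis"
  define \<delta> where "\<delta> = lip X\<^sub>2 (V f) - lip X\<^sub>1 f"
  have \<delta>: "\<delta> > 0" using \<open>\<not> _\<close> by (simp add: \<delta>_def)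
  interpret inv: unital_isometry X\<^sub>2 X\<^sub>1 Vinv by (rule inverse_unital_isometry)
  define r where "r = (\<lambda>y. a * Re (V f y) + b * Im (V f y))"
  have "continuous_on X\<^sub>2 r"
    unfolding r_def by (intro continuous_intros Lip_continuous[OF V_Lip[OF f]])
  then obtain y where y: "y \<in> X\<^sub>2" "\<And>z. z \<in> X\<^sub>2 \<Longrightarrow> r z \<le> r y"
    using continuous_attains_sup[OF compact(2) nonempty(2)] by blast
  have ry: "v - \<delta> \<le> r y"
    using inv.support_le[OF V_Lip[OF f] ab y(2)[unfolded r_def] x(1)] x(2)
    by (simp add: Vinv_V[OF f] r_def \<delta>_def)
  \<comment> \<open>Rotate the direction \<open>(a, b)\<close> by the angle with tangent
    \<open>\<gamma>\<close>, to the side given by the transversal component \<open>J\<close>. The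
    corner bounds \<open>f\<close> by \<open>C * v\<close> in the new direction, so
    \<open>support_le\<close> bounds \<open>V f\<close> by \<open>C * v - \<delta>\<close>. But at
    \<open>y\<close> the value is at least \<open>C * (v - \<delta>)\<close>, and
    \<open>C < 1\<close>.\<close>
  define J where "J = a * Im (V f y) - b * Re (V f y)"
  define C where "C = 1 / sqrt (1 + \<gamma>\<^sup>2)"
  define S where "S = (if J \<ge> 0 then \<gamma> * C else - (\<gamma> * C))"
  have "1 < sqrt (1 + \<gamma>\<^sup>2)" using \<gamma> by (simp add: real_less_rsqrt)
  then have C: "0 < C" "C < 1"
  proof -
    assume "1 < sqrt (1 + \<gamma>\<^sup>2)"
    moreover have "0 < 1 / s \<and> 1 / s < 1" if "1 < s" for s :: real using that by simp
    ultimately show "0 < C" "C < 1" unfolding C_def by blast+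
  qed
  have pos: "0 < 1 + \<gamma>\<^sup>2" by (rule add_pos_nonneg) simp_all
  then have "C\<^sup>2 = 1 / (1 + \<gamma>\<^sup>2)" by (simp only: C_def power_divide real_sqrt_pow2 less_imp_le) simp
  then have CC: "C\<^sup>2 * (1 + \<gamma>\<^sup>2) = 1" using pos by simp
  have S: "\<bar>S\<bar> = \<gamma> * C" "S * J \<ge> 0" "S\<^sup>2 = \<gamma>\<^sup>2 * C\<^sup>2"
    using \<gamma> C by (simp_all add: S_def power_mult_distrib abs_mult mult_nonneg_nonpos)
  have "(C * a - S * b) * Re (V f y) + (C * b + S * a) * Im (V f y) \<le> C * v + (lip X\<^sub>1 f - lip X\<^sub>2 (V f))"
  proof (rule support_le[OF f _ _ y(1)])
    have "(C * a - S * b)\<^sup>2 + (C * b + S * a)\<^sup>2 = (C\<^sup>2 + S\<^sup>2) * (a\<^sup>2 + b\<^sup>2)"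
      by (simp add: power2_eq_square algebra_simps)
    also have "\<dots> = 1" using CC ab S(3) by (simp add: algebra_simps)
    finally show "(C * a - S * b)\<^sup>2 + (C * b + S * a)\<^sup>2 = 1" .
    fix z assume z: "z \<in> X\<^sub>1"
    let ?Q = "a * Im (f z) - b * Re (f z)"
    have "(C * a - S * b) * Re (f z) + (C * b + S * a) * Im (f z)
        = C * (a * Re (f z) + b * Im (f z)) + S * ?Q"
      by (simp add: algebra_simps)
    also have "\<dots> \<le> C * (v - \<gamma> * \<bar>?Q\<bar>) + \<bar>S\<bar> * \<bar>?Q\<bar>"
      using C le[OF z] abs_ge_self[of "S * ?Q"]
      by (intro add_mono mult_left_mono) (auto simp: abs_mult)
    also have "\<dots> = C * v" unfolding S(1) by (simp add: algebra_simps)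
    finally show "(C * a - S * b) * Re (f z) + (C * b + S * a) * Im (f z) \<le> C * v" .
  qed
  then have "C * r y + S * J \<le> C * v - \<delta>"
    by (simp add: r_def J_def \<delta>_def algebra_simps)
  moreover have "C * (v - \<delta>) \<le> C * r y" using ry C by (intro mult_left_mono) auto
  ultimately have "\<delta> \<le> C * \<delta>" using S(2) by (simp add: algebra_simps)
  then show False using \<delta> C(2) by simp
qed

text \<open>A small spike at a point of maximal modulus creates a corner.\<close>

lemma lip_V_le:
  assumes f: "f \<in> Lip X\<^sub>1"
  shows "lip X\<^sub>2 (V f) \<le> lip X\<^sub>1 f"
proof (rule field_le_epsilon)
  fix e :: real assume e: "e > 0"
  define R where "R = sup_norm X\<^sub>1 f"
  obtain x where x: "x \<in> X\<^sub>1" "cmod (f x) = R" "\<And>z. z \<in> X\<^sub>1 \<Longrightarrow> cmod (f z) \<le> R"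
    using sup_norm_attained[OF compact(1) nonempty(1) f] unfolding R_def by metis
  show "lip X\<^sub>2 (V f) \<le> lip X\<^sub>1 f + e"
  proof (cases "R = 0")
    case True
    then have "f = (\<lambda>x. 0)" using x(3) by (intro Lip_ext[OF f Lip_zero]) auto
    then have "lip X\<^sub>2 (V f) = 0" using V_zero lip_cst[of X\<^sub>2 0] by (simp add: cst_def)
    then show ?thesis using e lip_nonneg[of X\<^sub>1 f] by simp
  next
    case False
    then have R: "R > 0" using x(2) by (metis norm_ge_zero order_le_less)
    define L where "L = lip X\<^sub>1 f"
    have L: "L \<ge> 0" by (simp add: L_def lip_nonneg)
    \<comment> \<open>The errors \<open>lip h \<le> \<alpha> * L\<close> and
      \<open>lip (V h) \<le> \<alpha> + \<alpha> * L\<close> then add up to at most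
      \<open>e\<close>.\<close>
    define \<alpha> where "\<alpha> = e / (1 + 2 * L)"
    have \<alpha>: "\<alpha> > 0" using e L by (simp add: \<alpha>_def)
    define w where "w = f x / of_real R"
    have w: "cmod w = 1" using x(2) R by (simp add: w_def norm_divide)
    have fx: "f x = of_real R * w" using R by (simp add: w_def)
    \<comment> \<open>The spike is a Lipschitz function of \<open>f z\<close> in the direction of
      \<open>f x\<close>, so it leaves the component of \<open>f\<close> across that direction
      unchanged.\<close>
    define h where "h = (\<lambda>z. if z \<in> X\<^sub>1 then of_real (\<alpha> * max 0 (1 - cmod (f z - f x))) * w else 0)"
    have hd: "cmod (h p - h q) \<le> \<alpha> * L * dist p q" if "p \<in> X\<^sub>1" "q \<in> X\<^sub>1" for p q
    proof -
      have "h p - h q = of_real (\<alpha> * (max 0 (1 - cmod (f p - f x)) - max 0 (1 - cmod (f q - f x)))) * w"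
        using that by (simp add: h_def algebra_simps)
      then have "cmod (h p - h q) = \<alpha> * \<bar>max 0 (1 - cmod (f p - f x)) - max 0 (1 - cmod (f q - f x))\<bar>"
        using w \<alpha> by (simp only: norm_mult norm_of_real abs_mult)
      also have "\<dots> \<le> \<alpha> * cmod (f p - f q)"
      proof (rule mult_left_mono)
        show "\<bar>max 0 (1 - cmod (f p - f x)) - max 0 (1 - cmod (f q - f x))\<bar> \<le> cmod (f p - f q)"
          using norm_triangle_ineq3[of "f p - f x" "f q - f x"] by auto
      qed (use \<alpha> in simp)
      also have "\<dots> \<le> \<alpha> * (L * dist p q)"
        using lip_bound[OF f that] \<alpha> by (intro mult_left_mono) (auto simp: L_def)
      finally show ?thesis by simp
    qed
    have h: "h \<in> Lip X\<^sub>1" by (rule LipI[OF hd]) (simp_all add: h_def)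
    have "lip X\<^sub>1 h \<le> \<alpha> * L" by (rule lip_le[OF hd]) (use \<alpha> L in auto)
    moreover have "sup_norm X\<^sub>1 h \<le> \<alpha>"
    proof (rule sup_norm_le)
      show "cmod (h z) \<le> \<alpha>" if "z \<in> X\<^sub>1" for z
        using that w \<alpha> by (simp add: h_def norm_mult mult_le_cancel_left1)
    qed (use \<alpha> in simp)
    ultimately have "sigma_norm X\<^sub>2 (V h) \<le> \<alpha> + \<alpha> * L" "lip X\<^sub>1 h \<le> \<alpha> * L"
      unfolding isometric[OF h] sigma_norm_eq[of X\<^sub>1] by simp_all
    then have Vh: "lip X\<^sub>2 (V h) \<le> \<alpha> + \<alpha> * L"
      using sup_norm_nonneg[of X\<^sub>2 "V h"] by (simp add: sigma_norm_eq)
    let ?F = "\<lambda>z. f z + h z"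
    have F: "?F \<in> Lip X\<^sub>1" by (rule Lip_add[OF f h])
    have ww: "(Re w)\<^sup>2 + (Im w)\<^sup>2 = 1" using w by (metis cmod_power2 one_power2)
    have "lip X\<^sub>2 (V ?F) \<le> lip X\<^sub>1 ?F"
    proof (rule corner_lip_le[OF F ww])
      show "min \<alpha> (1 / (2 * R)) > 0" using \<alpha> R by simp
      show "x \<in> X\<^sub>1" by (rule x)
      have "?F x = of_real (R + \<alpha>) * w" using x(1) fx by (simp add: h_def algebra_simps)
      then have "Re w * Re (?F x) + Im w * Im (?F x) = (R + \<alpha>) * ((Re w)\<^sup>2 + (Im w)\<^sup>2)"
        by (simp add: power2_eq_square algebra_simps)
      then show "Re w * Re (?F x) + Im w * Im (?F x) = R + \<alpha>" using ww by simp
    next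
      fix z assume z: "z \<in> X\<^sub>1"
      define P Q s where "P = Re w * Re (f z) + Im w * Im (f z)"
        and "Q = Re w * Im (f z) - Im w * Re (f z)" and "s = cmod (f z - f x)"
      define m where "m = \<alpha> * max 0 (1 - s)"
      have hz: "h z = of_real m * w" using z by (simp add: h_def m_def s_def)
      have "Re w * Re (?F z) + Im w * Im (?F z) = P + m * ((Re w)\<^sup>2 + (Im w)\<^sup>2)"
        by (simp add: hz P_def power2_eq_square algebra_simps)
      then have PF: "Re w * Re (?F z) + Im w * Im (?F z) = P + m" using ww by simp
      have QF: "Re w * Im (?F z) - Im w * Re (?F z) = Q"
        by (simp add: hz Q_def algebra_simps)
      have "Q = Im (cnj w * (f z - f x))" by (simp add: Q_def fx algebra_simps)
      then have Q: "\<bar>Q\<bar> \<le> s"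
        using abs_Im_le_cmod[of "cnj w * (f z - f x)"] w by (simp add: norm_mult s_def)
      have "s\<^sup>2 = (cmod (f z))\<^sup>2 - 2 * R * P + R\<^sup>2 * ((Re w)\<^sup>2 + (Im w)\<^sup>2)"
        by (simp only: s_def cmod_power2) (simp add: fx P_def power2_eq_square algebra_simps)
      moreover have "(cmod (f z))\<^sup>2 \<le> R\<^sup>2" by (rule power_mono[OF x(3)[OF z]]) simp
      ultimately have "2 * R * P \<le> 2 * R\<^sup>2 - s\<^sup>2" unfolding ww by simp
      then show "Re w * Re (?F z) + Im w * Im (?F z)
          \<le> R + \<alpha> - min \<alpha> (1 / (2 * R)) * \<bar>Re w * Im (?F z) - Im w * Re (?F z)\<bar>"
        unfolding PF QF m_def using R \<alpha> Q by (intro corner_inequality) (auto simp: s_def)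
    qed
    also have "\<dots> \<le> L + \<alpha> * L"
      using lip_add_le[OF f h] \<open>lip X\<^sub>1 h \<le> _\<close> by (simp add: L_def)
    finally have VF: "lip X\<^sub>2 (V ?F) \<le> L + \<alpha> * L" .
    have "V f = (\<lambda>y. V ?F y + - V h y)" by (simp add: add[OF f h])
    then have "lip X\<^sub>2 (V f) \<le> lip X\<^sub>2 (V ?F) + lip X\<^sub>2 (\<lambda>y. - V h y)"
      using lip_add_le[OF V_Lip[OF F] Lip_minus[OF V_Lip[OF h]]] by simp
    also have "lip X\<^sub>2 (\<lambda>y. - V h y) = lip X\<^sub>2 (V h)"
      by (simp add: lip_def lip_const_def norm_minus_commute)
    finally have "lip X\<^sub>2 (V f) \<le> L + \<alpha> * (1 + 2 * L)" using VF Vh by (simp add: algebra_simps)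
    then show ?thesis using L by (simp add: \<alpha>_def L_def)
  qed
qed

lemma lip_V: "f \<in> Lip X\<^sub>1 \<Longrightarrow> lip X\<^sub>2 (V f) = lip X\<^sub>1 f"
  using lip_V_le unital_isometry.lip_V_le[OF inverse_unital_isometry V_Lip] Vinv_V
  by (metis antisym)

lemma V_hull:
  assumes f: "f \<in> Lip X\<^sub>1" and s: "\<And>x. x \<in> X\<^sub>1 \<Longrightarrow> a * Re (f x) + b * Im (f x) \<le> s" and y: "y \<in> X\<^sub>2"
  shows "a * Re (V f y) + b * Im (V f y) \<le> s"
proof (cases "a = 0 \<and> b = 0")
  case True
  then show ?thesis using s nonempty(1) by auto
next
  case False
  define n where "n = sqrt (a\<^sup>2 + b\<^sup>2)"
  have n: "n > 0" using False by (simp add: n_def sum_power2_gt_zero_iff)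
  have "(a / n)\<^sup>2 + (b / n)\<^sup>2 = 1"
    using False by (simp add: n_def power_divide flip: add_divide_distrib)
  moreover have "a / n * Re (f x) + b / n * Im (f x) \<le> s / n" if "x \<in> X\<^sub>1" for x
    using s[OF that] n by (simp add: divide_right_mono flip: add_divide_distrib)
  ultimately have "a / n * Re (V f y) + b / n * Im (V f y) \<le> s / n"
    using support_le[OF f _ _ y] lip_V[OF f] by fastforce
  then show ?thesis using n by (simp add: divide_le_cancel flip: add_divide_distrib)
qed

section \<open>Order, modulus and composition\<close>

lemma V_abs_ge:
  assumes f: "f \<in> Lip X\<^sub>1" "\<And>x. x \<in> X\<^sub>1 \<Longrightarrow> Im (f x) = 0" and y: "y \<in> X\<^sub>2"
  shows "cmod (V f y) \<le> Re (V (\<lambda>x. of_real (cmod (f x))) y)" "Im (V f y) = 0"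
proof -
  let ?g = "\<lambda>x. complex_of_real (cmod (f x))"
  show Im: "Im (V f y) = 0"
    using V_hull[OF f(1) _ y, of 0 1 0] V_hull[OF f(1) _ y, of 0 "-1" 0] f(2) by simp
  have "Re (V f y) \<le> Re (V ?g y)"
    using V_hull[OF Lip_diff[OF f(1) Lip_cmod[OF f(1)]] _ y, of 1 0 0]
    by (simp add: V_diff[OF f(1) Lip_cmod[OF f(1)]] complex_Re_le_cmod)
  moreover have "- Re (V f y) \<le> Re (V ?g y)"
    using V_hull[OF Lip_add[OF f(1) Lip_cmod[OF f(1)]] _ y, of "-1" 0 0]
      abs_Re_le_cmod by (simp add: add[OF f(1) Lip_cmod[OF f(1)]]) (smt (verit))
  ultimately show "cmod (V f y) \<le> Re (V ?g y)" using Im by (simp add: cmod_def)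
qed

text \<open>\<open>V_abs_ge\<close> says \<open>\<bar>V f\<bar> \<le> V \<bar>f\<bar>\<close>. For
  the inverse at \<open>V f\<close> it says \<open>\<bar>f\<bar> \<le> Vinv \<bar>V f\<bar>\<close>,
  and applying the order-preserving \<open>V\<close> yields the converse.\<close>

lemma V_abs:
  assumes f: "f \<in> Lip X\<^sub>1" "\<And>x. x \<in> X\<^sub>1 \<Longrightarrow> Im (f x) = 0" and y: "y \<in> X\<^sub>2"
  shows "V (\<lambda>x. of_real (cmod (f x))) y = of_real (cmod (V f y))"
proof -
  interpret inv: unital_isometry X\<^sub>2 X\<^sub>1 Vinv by (rule inverse_unital_isometry)
  let ?g = "\<lambda>x. complex_of_real (cmod (f x))" and ?h = "\<lambda>y. complex_of_real (cmod (V f y))"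
  have g: "?g \<in> Lip X\<^sub>1" by (rule Lip_cmod[OF f(1)])
  have h: "?h \<in> Lip X\<^sub>2" by (rule Lip_cmod[OF V_Lip[OF f(1)]])
  let ?k = "\<lambda>x. ?g x - Vinv ?h x"
  have "1 * Re (?k x) + 0 * Im (?k x) \<le> 0" if "x \<in> X\<^sub>1" for x
    using inv.V_abs_ge(1)[OF V_Lip[OF f(1)] V_abs_ge(2)[OF f] that] by (simp add: Vinv_V[OF f(1)])
  then have "1 * Re (V ?k y) + 0 * Im (V ?k y) \<le> 0"
    by (rule V_hull[OF Lip_diff[OF g Vinv_Lip[OF h]] _ y])
  then have "Re (V ?g y) \<le> cmod (V f y)"
    by (simp add: V_diff[OF g Vinv_Lip[OF h]] V_Vinv[OF h])
  then show ?thesis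
    using V_abs_ge(1)[OF f y] V_abs_ge(2)[OF g _ y] by (simp add: complex_eq_iff)
qed

text \<open>By \<open>point_evaluation\<close>, \<open>V\<close> and its inverse are compositions
  with maps \<open>p\<close> and \<open>q\<close>. Testing on distance functions shows that
  \<open>p\<close> and \<open>q\<close> are mutually inverse and, since \<open>lip_V\<close> keeps
  their Lipschitz constant at most 1, that both are contractions, hence isometries.\<close>

lemma composition:
  obtains p where "isometry_onto p X\<^sub>2 X\<^sub>1" "\<And>f y. f \<in> Lip X\<^sub>1 \<Longrightarrow> y \<in> X\<^sub>2 \<Longrightarrow> V f y = f (p y)"
proof -
  have ev: "\<exists>x\<in>Y. \<forall>f\<in>Lip Y. W f z = f x"
    if "unital_isometry Y Z W" "z \<in> Z" for Y :: "'c::metric_space set" and Z :: "'d::metric_space set" and W z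
  proof -
    interpret W: unital_isometry Y Z W by (rule that(1))
    show ?thesis
      by (rule point_evaluation)
         (use W.compact W.nonempty W.add W.V_hull W.V_abs that(2) in auto)
  qed
  obtain p where p: "\<And>y. y \<in> X\<^sub>2 \<Longrightarrow> p y \<in> X\<^sub>1" "\<And>f y. f \<in> Lip X\<^sub>1 \<Longrightarrow> y \<in> X\<^sub>2 \<Longrightarrow> V f y = f (p y)"
    using ev[OF unital_isometry_axioms] by metis
  obtain q where q: "\<And>x. x \<in> X\<^sub>1 \<Longrightarrow> q x \<in> X\<^sub>2" "\<And>g x. g \<in> Lip X\<^sub>2 \<Longrightarrow> x \<in> X\<^sub>1 \<Longrightarrow> Vinv g x = g (q x)"
    using ev[OF inverse_unital_isometry] by metis
  have pq: "p (q x) = x" if x: "x \<in> X\<^sub>1" for x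
  proof -
    have "dist_fun X\<^sub>1 x (p (q x)) = Vinv (V (dist_fun X\<^sub>1 x)) x"
      unfolding q(2)[OF V_Lip[OF Lip_dist_fun] x] by (rule p(2)[OF Lip_dist_fun q(1)[OF x], symmetric])
    also have "\<dots> = 0" using x by (simp add: Vinv_V Lip_dist_fun) (simp add: dist_fun_def)
    finally show ?thesis using p(1)[OF q(1)[OF x]] by (simp add: dist_fun_def)
  qed
  have contract: "dist (r a) (r b) \<le> dist a b"
    if "unital_isometry Y Z W" "\<And>z. z \<in> Z \<Longrightarrow> r z \<in> Y"
      "\<And>f z. f \<in> Lip Y \<Longrightarrow> z \<in> Z \<Longrightarrow> W f z = f (r z)" "a \<in> Z" "b \<in> Z"
    for Y :: "'c::metric_space set" and Z :: "'d::metric_space set" and W r a b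
  proof -
    interpret W: unital_isometry Y Z W by (rule that(1))
    let ?f = "dist_fun Y (r b)"
    have "cmod (?f (r a) - ?f (r b)) \<le> lip Z (W ?f) * dist a b"
      using lip_bound[OF W.V_Lip[OF Lip_dist_fun] that(4,5), of "r b"] that
      by (simp add: Lip_dist_fun)
    also have "\<dots> \<le> 1 * dist a b"
      using lip_dist_fun by (intro mult_right_mono) (auto simp: W.lip_V Lip_dist_fun)
    finally show ?thesis using that by (simp add: dist_fun_def dist_commute)
  qed
  have qp: "q (p y) = y" if y: "y \<in> X\<^sub>2" for y
  proof -
    have "dist_fun X\<^sub>2 y (q (p y)) = V (Vinv (dist_fun X\<^sub>2 y)) y"
      unfolding p(2)[OF Vinv_Lip[OF Lip_dist_fun] y] by (rule q(2)[OF Lip_dist_fun p(1)[OF y], symmetric])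
    also have "\<dots> = 0" using y by (simp add: V_Vinv Lip_dist_fun) (simp add: dist_fun_def)
    finally show ?thesis using q(1)[OF p(1)[OF y]] by (simp add: dist_fun_def)
  qed
  have "isometry_onto p X\<^sub>2 X\<^sub>1"
    unfolding isometry_onto_def
  proof (intro conjI ballI)
    show "p ` X\<^sub>2 = X\<^sub>1" using p(1) q(1) pq by (metis image_eqI image_subsetI subsetI subset_antisym)
    fix a b assume ab: "a \<in> X\<^sub>2" "b \<in> X\<^sub>2"
    have "dist (p a) (p b) \<le> dist a b" by (rule contract[OF unital_isometry_axioms p ab])
    moreover have "dist (q (p a)) (q (p b)) \<le> dist (p a) (p b)"
      by (rule contract[OF inverse_unital_isometry q p(1)[OF ab(1)] p(1)[OF ab(2)]])
    ultimately show "dist (p a) (p b) = dist a b" using qp ab by simp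
  qed
  then show ?thesis using that p(2) by blast
qed

end

section \<open>2-local isometries\<close>

lemma complex_linear_isometry_inverse:
  fixes A :: "complex \<Rightarrow> complex"
  assumes A: "linear A" "\<And>c. cmod (A c) = cmod c"
  obtains K where "linear K" "\<And>c. cmod (K c) = cmod c" "\<And>c. K (A c) = c" "\<And>c. A (K c) = c"
proof -
  have "inj A"
  proof (rule injI)
    fix c d assume "A c = A d"
    then have "cmod (c - d) = 0" using linear_diff[OF A(1), of c d] A(2)[of "c - d"] by simp
    then show "c = d" by simp
  qed
  then obtain K where K: "linear K" "\<And>c. K (A c) = c" "\<And>c. A (K c) = c"
    using linear_injective_isomorphism[OF A(1)] by blast
  then show ?thesis using that[OF K(1) _ K(2,3)] A(2) by metis
qed

lemma Lip_isometry_comp: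
  assumes f: "f \<in> Lip X" and K: "linear K" "\<And>c. cmod (K c) = cmod c"
  shows "(\<lambda>x. K (f x)) \<in> Lip X" "sigma_norm X (\<lambda>x. K (f x)) = sigma_norm X f"
proof -
  have d: "cmod (K a - K b) = cmod (a - b)" for a b
    using K(2)[of "a - b"] by (simp add: linear_diff[OF K(1)])
  show "(\<lambda>x. K (f x)) \<in> Lip X"
    by (rule Lip_comp(1)[OF f, where C = 1]) (simp_all add: d linear_0[OF K(1)])
  show "sigma_norm X (\<lambda>x. K (f x)) = sigma_norm X f"
    by (simp add: sigma_norm_def unorm_def lip_const_def K(2) d)
qed

text \<open>Composing with the inverse \<open>K\<close> of \<open>A\<close> makes the isometry
  unital. Since \<open>K\<close> preserves moduli, the composition formula survives for the modulus
  of \<open>V f\<close>.\<close>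

lemma (in additive_isometry) modulus_composition:
  obtains p where "isometry_onto p X\<^sub>2 X\<^sub>1"
    "\<And>f y. f \<in> Lip X\<^sub>1 \<Longrightarrow> y \<in> X\<^sub>2 \<Longrightarrow> cmod (V f y) = cmod (f (p y))"
proof -
  obtain K where K: "linear K" "\<And>c. cmod (K c) = cmod c" "\<And>c. K (A c) = c" "\<And>c. A (K c) = c"
    using complex_linear_isometry_inverse[OF linear_A cmod_A] by blast
  interpret W: unital_isometry X\<^sub>1 X\<^sub>2 "\<lambda>f y. K (V f y)"
  proof
    show "(\<lambda>f y. K (V f y)) ` Lip X\<^sub>1 = Lip X\<^sub>2"
    proof (intro equalityI subsetI)
      fix g assume g: "g \<in> Lip X\<^sub>2"
      have Ag: "(\<lambda>y. A (g y)) \<in> Lip X\<^sub>2" by (rule Lip_isometry_comp(1)[OF g linear_A cmod_A])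
      have "g = (\<lambda>y. K (V (Vinv (\<lambda>y. A (g y))) y))" by (simp add: V_Vinv[OF Ag] K(3))
      then show "g \<in> (\<lambda>f y. K (V f y)) ` Lip X\<^sub>1" using Vinv_Lip[OF Ag] by blast
    next
      fix g assume "g \<in> (\<lambda>f y. K (V f y)) ` Lip X\<^sub>1"
      then show "g \<in> Lip X\<^sub>2" using Lip_isometry_comp(1)[OF V_Lip K(1,2)] by blast
    qed
    show "(\<lambda>y. K (V (\<lambda>x. f x + g x) y)) = (\<lambda>y. K (V f y) + K (V g y))"
      if "f \<in> Lip X\<^sub>1" "g \<in> Lip X\<^sub>1" for f g
      unfolding add[OF that] linear_add[OF K(1)] ..
    show "sigma_norm X\<^sub>2 (\<lambda>y. K (V f y)) = sigma_norm X\<^sub>1 f" if "f \<in> Lip X\<^sub>1" for f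
      unfolding Lip_isometry_comp(2)[OF V_Lip[OF that] K(1,2)] by (rule isometric[OF that])
    show "(\<lambda>y. K (V (cst X\<^sub>1 c) y)) = cst X\<^sub>2 c" for c
      unfolding V_cst by (auto simp: cst_def K(3) linear_0[OF K(1)])
  qed (fact compact nonempty)+
  obtain p where "isometry_onto p X\<^sub>2 X\<^sub>1"
      "\<And>f y. f \<in> Lip X\<^sub>1 \<Longrightarrow> y \<in> X\<^sub>2 \<Longrightarrow> K (V f y) = f (p y)"
    using W.composition by blast
  then show ?thesis using that K(2) by metis
qed

text \<open>A map preserving midpoints and 0 commutes with doubling, and a sum is the midpoint of
  the doubled summands.\<close>

lemma midpoint_additive:
  fixes S :: "('a::metric_space \<Rightarrow> complex) \<Rightarrow> 'b \<Rightarrow> complex"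
  assumes mid: "\<And>f g. f \<in> Lip X \<Longrightarrow> g \<in> Lip X \<Longrightarrow> S (\<lambda>x. (f x + g x) / 2) = (\<lambda>y. (S f y + S g y) / 2)"
    and zero: "S (\<lambda>x. 0) = (\<lambda>y. 0)" and f: "f \<in> Lip X" and g: "g \<in> Lip X"
  shows "S (\<lambda>x. f x + g x) = (\<lambda>y. S f y + S g y)"
proof -
  have double: "S (\<lambda>x. 2 * h x) = (\<lambda>y. 2 * S h y)" if "h \<in> Lip X" for h
  proof
    fix y
    have "S h = (\<lambda>y. S (\<lambda>x. 2 * h x) y / 2)"
      using mid[OF Lip_mult[OF that, of 2] Lip_zero] by (simp add: zero)
    then have "S h y = S (\<lambda>x. 2 * h x) y / 2" by (rule fun_cong)
    then show "S (\<lambda>x. 2 * h x) y = 2 * S h y" by (metis nonzero_mult_div_cancel_left times_divide_eq_right zero_neq_numeral)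
  qed
  have "S (\<lambda>x. (2 * f x + 2 * g x) / 2) = (\<lambda>y. (2 * S f y + 2 * S g y) / 2)"
    using mid[OF Lip_mult[OF f, of 2] Lip_mult[OF g, of 2]] double[OF f] double[OF g] by simp
  then show ?thesis by (simp add: add_divide_distrib)
qed

lemma Iso_modulus_composition:
  assumes X: "compact X\<^sub>1" "compact X\<^sub>2" "X\<^sub>1 \<noteq> {}" "X\<^sub>2 \<noteq> {}"
    and U: "U \<in> Iso (Lip X\<^sub>1) (sigma_norm X\<^sub>1) (Lip X\<^sub>2) (sigma_norm X\<^sub>2)"
  shows "\<exists>p. isometry_onto p X\<^sub>2 X\<^sub>1 \<and>
    (\<forall>f\<in>Lip X\<^sub>1. \<forall>g\<in>Lip X\<^sub>1. \<forall>y\<in>X\<^sub>2. cmod (U f y - U g y) = cmod (f (p y) - g (p y)))"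
proof -
  define V where "V = (\<lambda>f y. U f y - U (\<lambda>x. 0) y)"
  have UL: "U f \<in> Lip X\<^sub>2" if "f \<in> Lip X\<^sub>1" for f using U that by (auto simp: Iso_def)
  interpret additive_isometry X\<^sub>1 X\<^sub>2 V
  proof
    show "V ` Lip X\<^sub>1 = Lip X\<^sub>2"
    proof (intro equalityI subsetI)
      fix g assume "g \<in> Lip X\<^sub>2"
      then have "(\<lambda>y. g y + U (\<lambda>x. 0) y) \<in> U ` Lip X\<^sub>1"
        using U Lip_add[OF _ UL[OF Lip_zero]] by (simp add: Iso_def)
      then obtain f where "f \<in> Lip X\<^sub>1" "(\<lambda>y. g y + U (\<lambda>x. 0) y) = U f" by blast
      then show "g \<in> V ` Lip X\<^sub>1" by (metis (no_types, lifting) V_def add_diff_cancel_right' ext image_eqI)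
    qed (auto simp: V_def intro!: Lip_diff UL Lip_zero)
    show "V (\<lambda>x. f x + g x) = (\<lambda>y. V f y + V g y)" if "f \<in> Lip X\<^sub>1" "g \<in> Lip X\<^sub>1" for f g
      by (rule midpoint_additive[OF _ _ that])
         (simp_all add: V_def mazur_ulam_Lip[OF X(1,2) U] fun_eq_iff field_simps)
    show "sigma_norm X\<^sub>2 (V f) = sigma_norm X\<^sub>1 f" if "f \<in> Lip X\<^sub>1" for f
      using U that Lip_zero[of X\<^sub>1] by (auto simp: V_def Iso_def fun_diff_def)
  qed (use X in auto)
  obtain p where p: "isometry_onto p X\<^sub>2 X\<^sub>1"
      "\<And>f y. f \<in> Lip X\<^sub>1 \<Longrightarrow> y \<in> X\<^sub>2 \<Longrightarrow> cmod (V f y) = cmod (f (p y))"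
    using modulus_composition by blast
  have "cmod (U f y - U g y) = cmod (f (p y) - g (p y))"
    if "f \<in> Lip X\<^sub>1" "g \<in> Lip X\<^sub>1" "y \<in> X\<^sub>2" for f g y
  proof -
    have "U f y - U g y = V (\<lambda>x. f x - g x) y"
      unfolding V_diff[OF that(1,2)] by (simp add: V_def)
    then show ?thesis using p(2)[OF Lip_diff[OF that(1,2)] that(3)] by simp
  qed
  then show ?thesis using p(1) by blast
qed

text \<open>
  A map all of whose values at pairs of functions come from isometries is, after normalization,
  additive by \<open>strict_convexity\<close>. As it maps constants to themselves, its values at \<open>f\<close>
  lie in the range of \<open>f\<close>, and applying this to \<open>f + \<i> \<bar>f\<bar>\<close> shows that it preserves moduli of
  real functions.
\<close>

lemma two_local_composition:
  fixes X\<^sub>1 :: "'a::metric_space set" and X\<^sub>2 :: "'b::metric_space set"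
  assumes X: "compact X\<^sub>1" "compact X\<^sub>2" "X\<^sub>1 \<noteq> {}" "X\<^sub>2 \<noteq> {}"
    and SL: "\<And>f. f \<in> Lip X\<^sub>1 \<Longrightarrow> S f \<in> Lip X\<^sub>2" and S0: "S (\<lambda>x. 0) = (\<lambda>y. 0)"
    and iso: "\<And>f. f \<in> Lip X\<^sub>1 \<Longrightarrow> sigma_norm X\<^sub>2 (S f) = sigma_norm X\<^sub>1 f"
    and two: "\<And>f g. f \<in> Lip X\<^sub>1 \<Longrightarrow> g \<in> Lip X\<^sub>1 \<Longrightarrow> \<exists>p. isometry_onto p X\<^sub>2 X\<^sub>1 \<and>
      (\<forall>y\<in>X\<^sub>2. cmod (S f y - S g y) = cmod (f (p y) - g (p y)))"
  obtains A K q where "linear A" "\<And>c. cmod (A c) = cmod c" "linear K" "\<And>c. cmod (K c) = cmod c"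
    "\<And>c. A (K c) = c" "isometry_onto q X\<^sub>2 X\<^sub>1"
    "\<And>f y. f \<in> Lip X\<^sub>1 \<Longrightarrow> y \<in> X\<^sub>2 \<Longrightarrow> S f y = A (f (q y))"
proof -
  have mid: "S (\<lambda>x. (f x + g x) / 2) = (\<lambda>y. (S f y + S g y) / 2)" if f: "f \<in> Lip X\<^sub>1" and g: "g \<in> Lip X\<^sub>1" for f g
  proof -
    let ?m = "\<lambda>x. (f x + g x) / 2" and ?h = "\<lambda>x. (f x - g x) / 2"
    have m: "?m \<in> Lip X\<^sub>1" by (rule Lip_midpoint[OF f g])
    have h: "?h \<in> Lip X\<^sub>1" using Lip_mult[OF Lip_diff[OF f g], of "1 / 2"] by simp
    obtain p where p: "isometry_onto p X\<^sub>2 X\<^sub>1" "\<And>y. y \<in> X\<^sub>2 \<Longrightarrow> cmod (S f y - S ?m y) = cmod (f (p y) - ?m (p y))"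
      using two[OF f m] by blast
    obtain q where q: "isometry_onto q X\<^sub>2 X\<^sub>1" "\<And>y. y \<in> X\<^sub>2 \<Longrightarrow> cmod (S ?m y - S g y) = cmod (?m (q y) - g (q y))"
      using two[OF m g] by blast
    obtain r where r: "isometry_onto r X\<^sub>2 X\<^sub>1" "\<And>y. y \<in> X\<^sub>2 \<Longrightarrow> cmod (S f y - S g y) = cmod (f (r y) - g (r y))"
      using two[OF f g] by blast
    have e: "f x - ?m x = ?h x" "?m x - g x = ?h x" for x by (simp_all add: field_simps)
    \<comment> \<open>Up to isometries both halves have the modulus of \<open>?h\<close> and their
      sum has twice this modulus, so they coincide.\<close>
    have "(\<lambda>y. S f y - S ?m y) = (\<lambda>y. S ?m y - S g y)"
    proof (rule strict_convexity[OF X(1) h _ _ p(1) _ q(1) _ r(1)])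
      show "cmod (S f y - S ?m y) = cmod (?h (p y))" if "y \<in> X\<^sub>2" for y
        using p(2)[OF that] unfolding e .
      show "cmod (S ?m y - S g y) = cmod (?h (q y))" if "y \<in> X\<^sub>2" for y
        using q(2)[OF that] unfolding e .
      show "cmod (S f y - S ?m y + (S ?m y - S g y)) = 2 * cmod (?h (r y))" if "y \<in> X\<^sub>2" for y
        using r(2)[OF that] by (simp add: norm_divide)
    qed (intro Lip_diff SL f g m)+
    then have "S f y - S ?m y = S ?m y - S g y" for y by meson
    then show ?thesis by (simp add: fun_eq_iff field_simps)
  qed
  have add: "S (\<lambda>x. f x + g x) = (\<lambda>y. S f y + S g y)" if "f \<in> Lip X\<^sub>1" "g \<in> Lip X\<^sub>1" for f g
    by (rule midpoint_additive[OF mid S0 that])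
  define y0 where "y0 = (SOME y. y \<in> X\<^sub>2)"
  have y0: "y0 \<in> X\<^sub>2" unfolding y0_def using X(4) by (simp add: some_in_eq)
  define A where "A = (\<lambda>c. S (cst X\<^sub>1 c) y0)"
  have modc: "cmod (S (cst X\<^sub>1 c) y) = cmod c" if y: "y \<in> X\<^sub>2" for c y
  proof -
    obtain p where "isometry_onto p X\<^sub>2 X\<^sub>1" "cmod (S (cst X\<^sub>1 c) y) = cmod (cst X\<^sub>1 c (p y))"
      using two[OF Lip_cst Lip_zero] y by (auto simp: S0)
    then show ?thesis using y by (auto simp: cst_def isometry_onto_def)
  qed
  have Scst: "S (cst X\<^sub>1 c) y = A c" if y: "y \<in> X\<^sub>2" for c y
  proof -
    \<comment> \<open>The constant modulus uses up the whole norm and leaves 0 for the Lipschitz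
      constant.\<close>
    have "sup_norm X\<^sub>2 (S (cst X\<^sub>1 c)) = cmod c"
      using sup_norm_eqI[OF X(2) SL[OF Lip_cst] y0, of c] modc y0 by simp
    then have "lip X\<^sub>2 (S (cst X\<^sub>1 c)) = 0"
      using iso[OF Lip_cst, of c] sigma_norm_cst[OF X(1,3), of c] by (simp add: sigma_norm_eq)
    then show ?thesis
      using lip_bound[OF SL[OF Lip_cst] y y0, of c] by (simp add: A_def)
  qed
  have A: "linear A" "\<And>c. cmod (A c) = cmod c"
  proof -
    show n: "cmod (A c) = cmod c" for c unfolding A_def by (rule modc[OF y0])
    show "linear A"
    proof (rule additive_bounded_complex_linear)
      show "A (c + d) = A c + A d" for c d
      proof -
        have "cst X\<^sub>1 (c + d) = (\<lambda>x. cst X\<^sub>1 c x + cst X\<^sub>1 d x)" by (auto simp: cst_def)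
        then show ?thesis unfolding A_def using add[OF Lip_cst Lip_cst] by simp
      qed
    qed (simp add: n)
  qed
  obtain K where K: "linear K" "\<And>c. cmod (K c) = cmod c" "\<And>c. K (A c) = c" "\<And>c. A (K c) = c"
    using complex_linear_isometry_inverse[OF A] by blast
  have twoc: "\<exists>p. isometry_onto p X\<^sub>2 X\<^sub>1 \<and> (\<forall>y\<in>X\<^sub>2. cmod (K (S f y) - c) = cmod (f (p y) - c))"
    if f: "f \<in> Lip X\<^sub>1" for f c
  proof -
    obtain p where p: "isometry_onto p X\<^sub>2 X\<^sub>1"
        "\<forall>y\<in>X\<^sub>2. cmod (S f y - S (cst X\<^sub>1 c) y) = cmod (f (p y) - cst X\<^sub>1 c (p y))"
      using two[OF f Lip_cst] by blast
    have "cmod (K (S f y) - c) = cmod (f (p y) - c)" if y: "y \<in> X\<^sub>2" for y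
    proof -
      have "K (S f y) - c = K (S f y - S (cst X\<^sub>1 c) y)"
        by (simp add: Scst[OF y] linear_diff[OF K(1)] K(3))
      moreover have "p y \<in> X\<^sub>1" using p(1) y by (auto simp: isometry_onto_def)
      ultimately show ?thesis using p(2) y K(2) by (simp add: cst_def)
    qed
    then show ?thesis using p(1) by blast
  qed
  \<comment> \<open>Comparing \<open>f\<close> with the constant \<open>K (S f y)\<close> makes the
    left side of \<open>twoc\<close> vanish at \<open>y\<close>, so \<open>f\<close> takes this
    value at \<open>p y\<close>.\<close>
  have range: "\<exists>x\<in>X\<^sub>1. K (S f y) = f x" if f: "f \<in> Lip X\<^sub>1" and y: "y \<in> X\<^sub>2" for f y
  proof -
    obtain p where p: "isometry_onto p X\<^sub>2 X\<^sub>1" "\<forall>z\<in>X\<^sub>2. cmod (K (S f z) - K (S f y)) = cmod (f (p z) - K (S f y))"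
      using twoc[OF f, of "K (S f y)"] by blast
    have "cmod (f (p y) - K (S f y)) = 0" using bspec[OF p(2) y] by simp
    moreover have "p y \<in> X\<^sub>1" using p(1) y by (auto simp: isometry_onto_def)
    ultimately show ?thesis by (intro bexI[of _ "p y"]) simp_all
  qed
  have ev: "\<exists>x\<in>X\<^sub>1. \<forall>f\<in>Lip X\<^sub>1. K (S f y) = f x" if y: "y \<in> X\<^sub>2" for y
  proof (rule point_evaluation[OF X(1,3)])
    show "K (S (\<lambda>x. f x + g x) y) = K (S f y) + K (S g y)" if "f \<in> Lip X\<^sub>1" "g \<in> Lip X\<^sub>1" for f g
      by (simp add: add[OF that] linear_add[OF K(1)])
    show "a * Re (K (S f y)) + b * Im (K (S f y)) \<le> s"
      if "f \<in> Lip X\<^sub>1" "\<And>x. x \<in> X\<^sub>1 \<Longrightarrow> a * Re (f x) + b * Im (f x) \<le> s" for f a b s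
      using range[OF that(1) y] that(2) by metis
    show "K (S (\<lambda>x. of_real (cmod (f x))) y) = of_real (cmod (K (S f y)))"
      if f: "f \<in> Lip X\<^sub>1" and re: "\<And>x. x \<in> X\<^sub>1 \<Longrightarrow> Im (f x) = 0" for f
    proof -
      let ?g = "\<lambda>x. complex_of_real (cmod (f x))"
      have g: "?g \<in> Lip X\<^sub>1" by (rule Lip_cmod[OF f])
      have ig: "(\<lambda>x. \<i> * ?g x) \<in> Lip X\<^sub>1" by (rule Lip_mult[OF g])
      let ?u = "K (S f y)" and ?v = "K (S ?g y)" and ?w = "K (S (\<lambda>x. \<i> * ?g x) y)"
      have u: "Im ?u = 0" using range[OF f y] re by metis
      have v: "Im ?v = 0" using range[OF g y] by force
      have w: "Re ?w = 0" using range[OF ig y] by force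
      \<comment> \<open>The values of \<open>\<bar>f\<bar> + \<i> \<bar>f\<bar>\<close> lie on the
        diagonal, hence so does \<open>?v + ?w\<close>.\<close>
      have vw: "Im ?w = Re ?v"
      proof -
        obtain x where "K (S (\<lambda>x. ?g x + \<i> * ?g x) y) = ?g x + \<i> * ?g x"
          using range[OF Lip_add[OF g ig] y] by blast
        then have "?v + ?w = ?g x + \<i> * ?g x"
          by (simp add: add[OF g ig] linear_add[OF K(1)])
        then show ?thesis using v w by (simp add: complex_eq_iff)
      qed
      \<comment> \<open>A single point \<open>x\<close> yields \<open>f x\<close> and
        \<open>\<bar>f x\<bar>\<close> at once, as real and imaginary part.\<close>
      obtain x where x: "x \<in> X\<^sub>1" "K (S (\<lambda>x. f x + \<i> * ?g x) y) = f x + \<i> * ?g x"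
        using range[OF Lip_add[OF f ig] y] by blast
      then have "?u + ?w = f x + \<i> * ?g x"
        by (simp add: add[OF f ig] linear_add[OF K(1)])
      then have "Re ?u = Re (f x)" "Re ?v = cmod (f x)"
        using u w vw re[OF x(1)] by (simp_all add: complex_eq_iff)
      then show ?thesis using u v re[OF x(1)] by (simp add: complex_eq_iff cmod_def)
    qed
  qed
  then obtain q where q: "\<And>y. y \<in> X\<^sub>2 \<Longrightarrow> q y \<in> X\<^sub>1"
      "\<And>f y. f \<in> Lip X\<^sub>1 \<Longrightarrow> y \<in> X\<^sub>2 \<Longrightarrow> K (S f y) = f (q y)"
    by metis
  have distq: "\<exists>p. isometry_onto p X\<^sub>2 X\<^sub>1 \<and> (\<forall>y\<in>X\<^sub>2. dist x (q y) = dist x (p y))" if "x \<in> X\<^sub>1" for x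
  proof -
    obtain p where p: "isometry_onto p X\<^sub>2 X\<^sub>1"
        "\<forall>y\<in>X\<^sub>2. cmod (K (S (dist_fun X\<^sub>1 x) y) - 0) = cmod (dist_fun X\<^sub>1 x (p y) - 0)"
      using twoc[OF Lip_dist_fun] by blast
    have "dist x (q y) = dist x (p y)" if y: "y \<in> X\<^sub>2" for y
    proof -
      have "p y \<in> X\<^sub>1" using p(1) y by (auto simp: isometry_onto_def)
      then show ?thesis
        using bspec[OF p(2) y] q(1)[OF y] unfolding q(2)[OF Lip_dist_fun y] by (simp add: dist_fun_def)
    qed
    then show ?thesis using p(1) by blast
  qed
  have "isometry_onto q X\<^sub>2 X\<^sub>1"
    unfolding isometry_onto_def
  proof (intro conjI ballI equalityI subsetI)
    fix x assume "x \<in> X\<^sub>1"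
    then obtain p where p: "isometry_onto p X\<^sub>2 X\<^sub>1" "\<forall>y\<in>X\<^sub>2. dist x (q y) = dist x (p y)"
      using distq by blast
    obtain y where "y \<in> X\<^sub>2" "p y = x" using p(1) \<open>x \<in> X\<^sub>1\<close> by (auto simp: isometry_onto_def)
    then show "x \<in> q ` X\<^sub>2" using p(2) by force
  next
    fix a b assume ab: "a \<in> X\<^sub>2" "b \<in> X\<^sub>2"
    \<comment> \<open>At \<open>y = a\<close> the distance is 0, so \<open>p\<close> agrees with
      \<open>q\<close> at \<open>a\<close>; at \<open>y = b\<close> the isometry \<open>p\<close>
      then returns the distance of \<open>a\<close> and \<open>b\<close>.\<close>
    obtain p where p: "isometry_onto p X\<^sub>2 X\<^sub>1" "\<forall>y\<in>X\<^sub>2. dist (q a) (q y) = dist (q a) (p y)"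
      using distq[OF q(1)[OF ab(1)]] by blast
    then have "p a = q a" using ab by force
    then show "dist (q a) (q b) = dist a b" using p ab by (metis isometry_onto_def)
  qed (use q in auto)
  moreover have "S f y = A (f (q y))" if "f \<in> Lip X\<^sub>1" "y \<in> X\<^sub>2" for f y
    using q(2)[OF that] K(4) by metis
  ultimately show ?thesis using that[OF A K(1,2,4)] by blast
qed

theorem corollary14:
  fixes X\<^sub>1 :: "'a::metric_space set" and X\<^sub>2 :: "'b::metric_space set"
    and T :: "('a \<Rightarrow> complex) \<Rightarrow> ('b \<Rightarrow> complex)"
  assumes "compact X\<^sub>1" and "compact X\<^sub>2"
    and "T \<in> Lip X\<^sub>1 \<rightarrow> Lip X\<^sub>2"
    and "two_local_in_Iso (Lip X\<^sub>1) (sigma_norm X\<^sub>1) (Lip X\<^sub>2) (sigma_norm X\<^sub>2) T"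
  shows "T \<in> Iso (Lip X\<^sub>1) (sigma_norm X\<^sub>1) (Lip X\<^sub>2) (sigma_norm X\<^sub>2)"
proof -
  let ?I = "Iso (Lip X\<^sub>1) (sigma_norm X\<^sub>1) (Lip X\<^sub>2) (sigma_norm X\<^sub>2)"
  have TL: "T f \<in> Lip X\<^sub>2" if "f \<in> Lip X\<^sub>1" for f using assms(3) that by blast
  have two: "\<exists>U\<in>?I. T f = U f \<and> T g = U g" if "f \<in> Lip X\<^sub>1" "g \<in> Lip X\<^sub>1" for f g
    using assms(4) that unfolding two_local_in_Iso_def by blast
  have isoT: "sigma_norm X\<^sub>2 (T f - T g) = sigma_norm X\<^sub>1 (f - g)" if fg: "f \<in> Lip X\<^sub>1" "g \<in> Lip X\<^sub>1" for f g
  proof -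
    obtain U where "U \<in> ?I" "T f = U f" "T g = U g" using two[OF fg] by blast
    then show ?thesis using fg by (simp add: Iso_def)
  qed
  have "T ` Lip X\<^sub>1 = Lip X\<^sub>2"
  proof (cases "X\<^sub>2 = {}")
    case True
    then have "Lip X\<^sub>2 = {\<lambda>y. 0}" using Lip_zero[of X\<^sub>2] by (auto simp: Lip_outside)
    then show ?thesis using TL Lip_zero[of X\<^sub>1] by (auto simp: image_iff)
  next
    case False
    \<comment> \<open>2-locality supplies some surjective isometry, and a one-element
      \<open>Lip\<close> cannot be mapped onto a set containing the distinct constants 0 and
      1.\<close>
    have "X\<^sub>1 \<noteq> {}"
    proof
      assume "X\<^sub>1 = {}"
      then have "Lip X\<^sub>1 = {\<lambda>x. 0}" using Lip_zero[of X\<^sub>1] by (auto simp: Lip_outside)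
      moreover obtain U where "U \<in> ?I" using two[OF Lip_zero Lip_zero] by blast
      ultimately have "Lip X\<^sub>2 = {U (\<lambda>x. 0)}" by (auto simp: Iso_def)
      then have "cst X\<^sub>2 1 = cst X\<^sub>2 0" using Lip_cst[of X\<^sub>2 0] Lip_cst[of X\<^sub>2 1] by simp
      then show False using False by (auto simp: cst_def fun_eq_iff split: if_splits)
    qed
    define S where "S = (\<lambda>f y. T f y - T (\<lambda>x. 0) y)"
    obtain A K q where A: "linear A" "\<And>c. cmod (A c) = cmod c" and K: "linear K" "\<And>c. cmod (K c) = cmod c"
      "\<And>c. A (K c) = c" and q: "isometry_onto q X\<^sub>2 X\<^sub>1"
      and Sq: "\<And>f y. f \<in> Lip X\<^sub>1 \<Longrightarrow> y \<in> X\<^sub>2 \<Longrightarrow> S f y = A (f (q y))"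
    proof (rule two_local_composition[OF assms(1,2) \<open>X\<^sub>1 \<noteq> {}\<close> False, of S])
      show "S f \<in> Lip X\<^sub>2" if "f \<in> Lip X\<^sub>1" for f
        unfolding S_def by (intro Lip_diff TL that Lip_zero)
      show "S (\<lambda>x. 0) = (\<lambda>y. 0)" by (simp add: S_def)
      show "sigma_norm X\<^sub>2 (S f) = sigma_norm X\<^sub>1 f" if "f \<in> Lip X\<^sub>1" for f
        using isoT[OF that Lip_zero] by (simp add: S_def fun_diff_def)
      show "\<exists>p. isometry_onto p X\<^sub>2 X\<^sub>1 \<and> (\<forall>y\<in>X\<^sub>2. cmod (S f y - S g y) = cmod (f (p y) - g (p y)))"
        if fg: "f \<in> Lip X\<^sub>1" "g \<in> Lip X\<^sub>1" for f g
      proof -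
        obtain U where U: "U \<in> ?I" "T f = U f" "T g = U g" using two[OF fg] by blast
        then show ?thesis
          using Iso_modulus_composition[OF assms(1,2) \<open>X\<^sub>1 \<noteq> {}\<close> False U(1)] fg
          by (simp add: S_def) blast
      qed
    qed blast
    have "g \<in> T ` Lip X\<^sub>1" if g: "g \<in> Lip X\<^sub>2" for g
    proof -
      \<comment> \<open>The equation \<open>A (f (q y)) = g y - T (\<lambda>x. 0) y\<close> is
        solved by \<open>h\<close> composed with the inverse \<open>r\<close> of
        \<open>q\<close>.\<close>
      define h where "h = (\<lambda>y. K (g y - T (\<lambda>x. 0) y))"
      have h: "h \<in> Lip X\<^sub>2"
        unfolding h_def by (rule Lip_isometry_comp(1)[OF Lip_diff[OF g TL[OF Lip_zero]] K(1,2)])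
      define r where "r = inv_into X\<^sub>2 q"
      have r: "r x \<in> X\<^sub>2" "q (r x) = x" if "x \<in> X\<^sub>1" for x
        using q that by (auto simp: r_def isometry_onto_def inv_into_into f_inv_into_f)
      have rq: "r (q y) = y" if "y \<in> X\<^sub>2" for y
      proof -
        have "q y \<in> X\<^sub>1" using q that by (auto simp: isometry_onto_def)
        then have "dist (r (q y)) y = dist (q y) (q y)"
          using q r that by (metis isometry_onto_def)
        then show ?thesis by simp
      qed
      define f where "f = (\<lambda>x. if x \<in> X\<^sub>1 then h (r x) else 0)"
      have f: "f \<in> Lip X\<^sub>1"
      proof (rule LipI)
        show "cmod (f x - f y) \<le> lip X\<^sub>2 h * dist x y" if "x \<in> X\<^sub>1" "y \<in> X\<^sub>1" for x y
        proof -
          have "dist (q (r x)) (q (r y)) = dist (r x) (r y)"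
            using q r(1)[OF that(1)] r(1)[OF that(2)] unfolding isometry_onto_def by blast
          then have "dist (r x) (r y) = dist x y" using r(2) that by simp
          then show ?thesis using lip_bound[OF h r(1)[OF that(1)] r(1)[OF that(2)]] that
            by (simp add: f_def)
        qed
      qed (simp add: f_def)
      have "T f = g"
      proof (rule Lip_ext[OF TL[OF f] g])
        fix y assume y: "y \<in> X\<^sub>2"
        then have "q y \<in> X\<^sub>1" using q by (auto simp: isometry_onto_def)
        then have "S f y = g y - T (\<lambda>x. 0) y"
          using Sq[OF f y] rq[OF y] K(3) by (simp add: f_def h_def)
        then show "T f y = g y" by (simp add: S_def)
      qed
      then show ?thesis using f by blast
    qed
    then show ?thesis using TL by blast
  qed
  then show ?thesis using isoT by (simp add: Iso_def)
qed

end
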